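(* Let $M:\mathbb{R}^{n_p}\to\mathbb{R}^{n_p\times n_p}$, $f:\mathbb{R}^{n_p}\times\mathbb{R}^{n_p}\to\mathbb{R}^{n_p}$ and $g:\mathbb{R}^{n_p}\to\mathbb{R}^{n_\lambda}$ ($n_\lambda\le n_p$) be analytic, and let $G(p)=\partial g/\partial p\in\mathbb{R}^{n_\lambda\times n_p}$ be the Jacobian of $g$. Assume that $\operatorname{rank}G(p)=n_\lambda$ and that $M(p)$ is symmetric and positive definite for all $p$. Let $p_0,v_0\in\mathbb{R}^{n_p}$ satisfy $g(p_0)=0$ and $G(p_0)v_0=0$. Set $p^{(0)}=p_0$, $v^{(0)}=v_0$, $p^{(1)}=L^{-1}v^{(0)}$, and for $n\ge 2$ consider the linear system for the unknowns $p^{(n)}$ and $L^{-2}\lambda^{(n-2)}$ $$M(p^{(0)})\,p^{(n)}+G^{\mathsf T}(p^{(0)})\,L^{-2}\lambda^{(n-2)}=R,\qquad G(p^{(0)})\,p^{(n)}=S,$$ where $$R=L^{-2}\Big(f^{(n-2)}-\sum_{k=0}^{n-3}\big((G^{\mathsf T}(p))^{(n-2-k)}\lambda^{(k)}+(M(p))^{(n-2-k)}z^{(k)}\big)\Big),\qquad S=-\frac1n\sum_{i=1}^{n-1}i\left(\frac{\partial g^{(n-i)}}{\partial p^{(0)}}\right)p^{(i)},$$ with $v^{(n-1)}=Lp^{(n)}$, and with $z^{(k)}$ ($0\le k\le n-3$) determined by $$M(p^{(0)})z^{(k)}=f^{(k)}-G^{\mathsf T}(p^{(0)})\lambda^{(k)}-\sum_{l=0}^{k-1}\big((G^{\mathsf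 T}(p))^{(k-l)}\lambda^{(l)}+(M(p))^{(k-l)}z^{(l)}\big).$$ Then for every $n\ge 2$ this system determines $p^{(n)}$ and $L^{-2}\lambda^{(n-2)}$ uniquely from the previous iterates. Moreover, writing $M_0=M(p^{(0)})$ and $G_0=G(p^{(0)})$, $$L^{-2}\lambda^{(n-2)}=(G_0M_0^{-1}G_0^{\mathsf T})^{-1}\,(G_0M_0^{-1}R-S),$$ $$\lambda^{(n-2)}=(G_0M_0^{-1}G_0^{\mathsf T})^{-1}\,(G_0M_0^{-1}L^2R-L^2S),$$ $$p^{(n)}=M_0^{-1}R-M_0^{-1}G_0^{\mathsf T}(G_0M_0^{-1}G_0^{\mathsf T})^{-1}\,(G_0M_0^{-1}R-S).$$
   Context: The setting is the Adomian decomposition of the Euler-Lagrange equations $\frac{dp}{dt}=v$, $M(p)\frac{dv}{dt}=f(p,v)-G^{\mathsf T}(p)\lambda$, $0=g(p)$, $t\ge 0$, with $p(0)=p_0$, $v(0)=v_0$, where one seeks $p=\sum_{n\ge0}p^{(n)}$, $v=\sum_{n\ge0}v^{(n)}$, $\lambda=\sum_{n\ge0}\lambda^{(n)}$. All iterates $p^{(n)},v^{(n)},z^{(n)}$ (values in $\mathbb{R}^{n_p}$) and $\lambda^{(n)}$ (values in $\mathbb{R}^{n_\lambda}$) are functions of $t\ge 0$. Operators: $Lx=dx/dt$, $(L^{-1}x)(t)=\int_0^t x(s)\,ds$, $L^{-2}=L^{-1}L^{-1}$ and $L^2=LL$. Adomian polynomials: for an analytic (possibly vector- or matrix-valued) function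 $N(w)$ of a vector $w=\sum_{i\ge0}w^{(i)}$, $$N^{(k)}=N^{(k)}(w^{(0)},\ldots,w^{(k)})=\frac1{k!}\frac{d^k}{d\mu^k}\left(N\Big(\sum_{i=0}^\infty\mu^iw^{(i)}\Big)\right)_{\mu=0},\qquad k\ge0,$$ the sum being formal (only the terms with $i\le k$ contribute). Here $f^{(k)}$ is the $k$-th Adomian polynomial of $f(p,v)$ with $w=(p,v)$; $g^{(k)}$, $(G^{\mathsf T}(p))^{(k)}$ and $(M(p))^{(k)}$ are those of $g(p)$, $G^{\mathsf T}(p)$ and $M(p)$ with $w=p$. The expression $\partial g^{(k)}/\partial p^{(0)}$ is the partial Jacobian of $g^{(k)}(p^{(0)},\ldots,p^{(k)})$ with respect to the argument $p^{(0)}$, evaluated at the iterates. Empty sums are zero. *)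

theory Defs
  imports "HOL-Analysis.Analysis"
begin

text \<open>Real analyticity in several real variables: near every point the function is the sum of a
  multi-index power series.  A multi-index is a function on the (finite) basis, extensional outside
  it; the unconditional summation of \<open>has_sum\<close> makes an enumeration of the multi-indices
  unnecessary.\<close>

definition real_analytic :: "('a::euclidean_space \<Rightarrow> 'b::euclidean_space) \<Rightarrow> bool" where
  "real_analytic h \<longleftrightarrow>
    (\<forall>x. \<exists>r>0. \<exists>c :: ('a \<Rightarrow> nat) \<Rightarrow> 'b. \<forall>y\<in>ball x r.
      ((\<lambda>\<alpha>. (\<Prod>b\<in>Basis. ((y - x) \<bullet> b) ^ \<alpha> b) *\<^sub>R c \<alpha>) has_sum h y) (Basis \<rightarrow>\<^sub>E UNIV))"

definition pos_def :: "real^'n^'n \<Rightarrow> bool" where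
  "pos_def A \<longleftrightarrow> (\<forall>y. y \<noteq> 0 \<longrightarrow> y \<bullet> (A *v y) > 0)"

text \<open>Functions of time \<open>t \<ge> 0\<close> are total functions on the reals whose values at \<open>t < 0\<close> are never
  used; accordingly derivatives in time are taken within \<open>{0..}\<close> (one-sided at \<open>0\<close>).\<close>

definition Lop :: "(real \<Rightarrow> 'a::euclidean_space) \<Rightarrow> real \<Rightarrow> 'a" where
  "Lop x t = vector_derivative x (at t within {0..})"

definition Linv :: "(real \<Rightarrow> 'a::euclidean_space) \<Rightarrow> real \<Rightarrow> 'a" where
  "Linv x t = integral {0..t} x"

text \<open>\<open>adomian N w k\<close> is the \<open>k\<close>-th Adomian polynomial of \<open>N\<close> at the values \<open>w 0, \<dots>, w k\<close>.  The formal
  sum over all \<open>i\<close> is truncated at \<open>i = k\<close>, as later terms do not contribute.\<close>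

definition adomian ::
  "('a::euclidean_space \<Rightarrow> 'b::euclidean_space) \<Rightarrow> (nat \<Rightarrow> 'a) \<Rightarrow> nat \<Rightarrow> 'b" where
  "adomian N w k =
    (1 / fact k) *\<^sub>R
      (((\<lambda>h x. vector_derivative h (at x)) ^^ k) (\<lambda>\<mu>. N (\<Sum>i\<le>k. \<mu> ^ i *\<^sub>R w i))) 0"

text \<open>Partial Jacobian of the \<open>k\<close>-th Adomian polynomial with respect to its argument \<open>w 0\<close>.\<close>

definition adomian_jac0 :: "(real^'n \<Rightarrow> real^'l) \<Rightarrow> (nat \<Rightarrow> real^'n) \<Rightarrow> nat \<Rightarrow> real^'n^'l" where
  "adomian_jac0 g w k = jacobian (\<lambda>x. adomian g (w(0 := x)) k) (at (w 0))"

text \<open>With \<open>j = n - 2\<close>, the function of which \<open>R\<close> is the twofold integral; with \<open>j = k\<close>,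
  the right-hand side of the equation for \<open>z k\<close> without the term in \<open>\<lambda> k\<close>.\<close>

definition adomian_rhs ::
  "(real^'n \<Rightarrow> real^'n^'n) \<Rightarrow> ((real^'n) \<times> (real^'n) \<Rightarrow> real^'n) \<Rightarrow> (real^'n \<Rightarrow> real^'n^'l)
    \<Rightarrow> (nat \<Rightarrow> real \<Rightarrow> real^'n) \<Rightarrow> (nat \<Rightarrow> real \<Rightarrow> real^'n)
    \<Rightarrow> (nat \<Rightarrow> real \<Rightarrow> real^'l) \<Rightarrow> (nat \<Rightarrow> real \<Rightarrow> real^'n) \<Rightarrow> nat \<Rightarrow> real \<Rightarrow> real^'n" where
  "adomian_rhs M f G p v lam z j t =
    adomian f (\<lambda>i. (p i t, v i t)) j
    - (\<Sum>k<j. adomian (\<lambda>x. transpose (G x)) (\<lambda>i. p i t) (j - k) *v lam k t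
             + adomian M (\<lambda>i. p i t) (j - k) *v z k t)"

definition sysR ::
  "(real^'n \<Rightarrow> real^'n^'n) \<Rightarrow> ((real^'n) \<times> (real^'n) \<Rightarrow> real^'n) \<Rightarrow> (real^'n \<Rightarrow> real^'n^'l)
    \<Rightarrow> (nat \<Rightarrow> real \<Rightarrow> real^'n) \<Rightarrow> (nat \<Rightarrow> real \<Rightarrow> real^'n)
    \<Rightarrow> (nat \<Rightarrow> real \<Rightarrow> real^'l) \<Rightarrow> (nat \<Rightarrow> real \<Rightarrow> real^'n) \<Rightarrow> nat \<Rightarrow> real \<Rightarrow> real^'n" where
  "sysR M f G p v lam z n = Linv (Linv (adomian_rhs M f G p v lam z (n - 2)))"

definition sysS ::
  "(real^'n \<Rightarrow> real^'l) \<Rightarrow> (nat \<Rightarrow> real \<Rightarrow> real^'n) \<Rightarrow> nat \<Rightarrow> real \<Rightarrow> real^'l" where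
  "sysS g p n t =
    - ((1 / real n) *\<^sub>R
        (\<Sum>i=1..n-1. real i *\<^sub>R (adomian_jac0 g (\<lambda>j. p j t) (n - i) *v p i t)))"

text \<open>The linear system of step \<open>n\<close>, in the unknown functions \<open>P\<close> (for \<open>p n\<close>) and \<open>\<Lambda>\<close> (for the
  twofold integral of \<open>lam (n - 2)\<close>).\<close>

definition solves_system ::
  "(real^'n \<Rightarrow> real^'n^'n) \<Rightarrow> ((real^'n) \<times> (real^'n) \<Rightarrow> real^'n)
    \<Rightarrow> (real^'n \<Rightarrow> real^'l) \<Rightarrow> (real^'n \<Rightarrow> real^'n^'l)
    \<Rightarrow> (nat \<Rightarrow> real \<Rightarrow> real^'n) \<Rightarrow> (nat \<Rightarrow> real \<Rightarrow> real^'n)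
    \<Rightarrow> (nat \<Rightarrow> real \<Rightarrow> real^'l) \<Rightarrow> (nat \<Rightarrow> real \<Rightarrow> real^'n) \<Rightarrow> nat
    \<Rightarrow> (real \<Rightarrow> real^'n) \<Rightarrow> (real \<Rightarrow> real^'l) \<Rightarrow> bool" where
  "solves_system M f g G p v lam z n P \<Lambda> \<longleftrightarrow>
    (\<forall>t\<ge>0. M (p 0 t) *v P t + transpose (G (p 0 t)) *v \<Lambda> t = sysR M f G p v lam z n t
          \<and> G (p 0 t) *v P t = sysS g p n t)"

definition solves_z ::
  "(real^'n \<Rightarrow> real^'n^'n) \<Rightarrow> ((real^'n) \<times> (real^'n) \<Rightarrow> real^'n) \<Rightarrow> (real^'n \<Rightarrow> real^'n^'l)
    \<Rightarrow> (nat \<Rightarrow> real \<Rightarrow> real^'n) \<Rightarrow> (nat \<Rightarrow> real \<Rightarrow> real^'n)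
    \<Rightarrow> (nat \<Rightarrow> real \<Rightarrow> real^'l) \<Rightarrow> (nat \<Rightarrow> real \<Rightarrow> real^'n) \<Rightarrow> nat \<Rightarrow> bool" where
  "solves_z M f G p v lam z k \<longleftrightarrow>
    (\<forall>t\<ge>0. M (p 0 t) *v z k t =
      adomian_rhs M f G p v lam z k t - transpose (G (p 0 t)) *v lam k t)"

text \<open>The scheme has been carried out up to and including step \<open>N\<close>: the iterates \<open>p 0, \<dots>, p N\<close>,
  \<open>v 0, \<dots>, v (N - 1)\<close>, and \<open>lam k\<close>, \<open>z k\<close> for \<open>k + 2 \<le> N\<close> obey all defining relations; entries with
  larger index are unconstrained.  Continuity of \<open>lam (n - 2)\<close> is what lets it be recovered from
  its twofold integral.\<close>

definition iterates_upto ::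
  "(real^'n \<Rightarrow> real^'n^'n) \<Rightarrow> ((real^'n) \<times> (real^'n) \<Rightarrow> real^'n)
    \<Rightarrow> (real^'n \<Rightarrow> real^'l) \<Rightarrow> (real^'n \<Rightarrow> real^'n^'l) \<Rightarrow> real^'n \<Rightarrow> real^'n \<Rightarrow> nat
    \<Rightarrow> (nat \<Rightarrow> real \<Rightarrow> real^'n) \<Rightarrow> (nat \<Rightarrow> real \<Rightarrow> real^'n)
    \<Rightarrow> (nat \<Rightarrow> real \<Rightarrow> real^'l) \<Rightarrow> (nat \<Rightarrow> real \<Rightarrow> real^'n) \<Rightarrow> bool" where
  "iterates_upto M f g G p0 v0 N p v lam z \<longleftrightarrow>
    (\<forall>t\<ge>0. p 0 t = p0 \<and> v 0 t = v0 \<and> p 1 t = Linv (v 0) t) \<and>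
    (\<forall>n. 2 \<le> n \<and> n \<le> N \<longrightarrow>
       continuous_on {0..} (lam (n - 2)) \<and>
       solves_system M f g G p v lam z n (p n) (Linv (Linv (lam (n - 2)))) \<and>
       p n differentiable_on {0..} \<and> (\<forall>t\<ge>0. v (n - 1) t = Lop (p n) t) \<and>
       solves_z M f G p v lam z (n - 2))"

end

theory Submission
  imports Defs
begin

text \<open>
  The linear algebra of one step is block elimination.  The mass matrix at the initial position is
  positive definite, and because the constraint Jacobian has full row rank, so is the Schur
  complement \<open>K\<close> (\<open>pos_def_schur\<close>); hence the system has a unique solution pointwise in time, given
  by the displayed formulas (\<open>saddle_system_iff\<close>).

  The point that needs an idea is that the second unknown must be a twofold integral of a
  continuous function, so that the multiplier itself can be recovered.  This holds because every
  iterate is a monomial in time: \<open>p n\<close>, \<open>v n\<close>, \<open>lam n\<close> and \<open>z n\<close> all have degree \<open>n\<close>.  Indeed,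
  Adomian polynomials are homogeneous if the \<open>i\<close>-th argument is given weight \<open>i\<close>
  (\<open>adomian_scaled\<close>, and \<open>adomian_jac0_scaled\<close> for the Jacobian), so at step \<open>n\<close> the function
  under the twofold integral in \<open>R\<close> has degree \<open>n - 2\<close>, and both \<open>R\<close> and \<open>S\<close> have degree \<open>n\<close>.  The
  solution of the system then has degree \<open>n \<ge> 2\<close>, and its second derivative is the multiplier
  (\<open>iter_homog\<close>, \<open>iter_extend\<close>).  Monomials are differentiable as often as desired, which
  settles all regularity claims.

  Homogeneity relies on the iterated derivatives in the Adomian polynomials existing.  For this,
  real-analytic functions are shown to be infinitely differentiable by differentiating their power
  series term by term (\<open>power_series_at_deriv\<close>, \<open>real_analytic_smooth\<close>), and the iterated
  derivatives along a polynomial curve are kept in a class that is closed under further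
  differentiation (\<open>jet_deriv\<close>, \<open>jet_differentiable\<close>).
\<close>

section \<open>Real-analytic functions are infinitely differentiable\<close>

lemma has_derivative_sums_bounded:
  fixes f :: "nat \<Rightarrow> 'a::real_normed_vector \<Rightarrow> 'b::banach"
  assumes S: "convex S" "open S" and x: "x \<in> S" and B: "summable B"
    and der: "\<And>n y. y \<in> S \<Longrightarrow> (f n has_derivative f' n y) (at y)"
    and bound: "\<And>n y h. y \<in> S \<Longrightarrow> norm (f' n y h) \<le> B n * norm h"
    and F: "\<And>y. y \<in> S \<Longrightarrow> (\<lambda>n. f n y) sums F y"
  shows "(F has_derivative (\<lambda>h. \<Sum>n. f' n x h)) (at x)"
proof -
  have summ: "summable (\<lambda>n. norm (f' n y h))" if "y \<in> S" for y h
    using bound[OF that] by (intro summable_comparison_test'[OF summable_mult2[OF B]]) auto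
  have "\<exists>g. \<forall>y\<in>S. (\<lambda>n. f n y) sums (g y) \<and> (g has_derivative (\<lambda>h. \<Sum>n. f' n y h)) (at y within S)"
  proof (rule has_derivative_series[where l = "F x", OF S(1)])
    show "(f n has_derivative f' n y) (at y within S)" if "y \<in> S" for n y
      using der[OF that] by (rule has_derivative_at_withinI)
    show "x \<in> S" by (rule x)
    show "(\<lambda>n. f n x) sums F x" by (rule F[OF x])
    fix e :: real assume "e > 0"
    then obtain N where N: "\<And>n. n \<ge> N \<Longrightarrow> norm (\<Sum>i. B (i + n)) < e"
      using suminf_exist_split[OF _ B] by metis
    have "norm ((\<Sum>i<n. f' i y h) - (\<Sum>i. f' i y h)) \<le> e * norm h"
      if n: "n \<ge> N" and y: "y \<in> S" for n y h
    proof -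
      have s: "summable (\<lambda>i. f' i y h)" using summ[OF y] by (rule summable_norm_cancel)
      have "norm ((\<Sum>i<n. f' i y h) - (\<Sum>i. f' i y h)) = norm (\<Sum>i. f' (i + n) y h)"
        using suminf_split_initial_segment[OF s, of n] by (simp add: norm_minus_commute)
      also have "\<dots> \<le> (\<Sum>i. B (i + n) * norm h)"
        by (intro norm_suminf_le bound y summable_mult2 summable_ignore_initial_segment B)
      also have "\<dots> = (\<Sum>i. B (i + n)) * norm h"
        by (rule suminf_mult2[symmetric]) (intro summable_ignore_initial_segment B)
      also have "\<dots> \<le> e * norm h"
        using N[OF n] by (intro mult_right_mono) auto
      finally show ?thesis .
    qed
    then show "\<forall>\<^sub>F n in sequentially. \<forall>y\<in>S. \<forall>h.
        norm ((\<Sum>i<n. f' i y h) - (\<Sum>i. f' i y h)) \<le> e * norm h"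
      unfolding eventually_sequentially by blast
  qed
  then obtain g where g: "\<And>y. y \<in> S \<Longrightarrow> (\<lambda>n. f n y) sums (g y)"
    "(g has_derivative (\<lambda>h. \<Sum>n. f' n x h)) (at x within S)" using x by blast
  have "g y = F y" if "y \<in> S" for y
    using g(1)[OF that] F[OF that] by (rule sums_unique2)
  then have "(F has_derivative (\<lambda>h. \<Sum>n. f' n x h)) (at x within S)"
    by (intro has_derivative_transform[OF x _ g(2)]) auto
  then show ?thesis by (simp add: at_within_open[OF x S(2)])
qed

text \<open>Exponents are functions on the whole space, but only their values on the basis matter.\<close>

definition mono_at :: "('a::euclidean_space \<Rightarrow> nat) \<Rightarrow> 'a \<Rightarrow> real" where
  "mono_at \<alpha> h = (\<Prod>b\<in>Basis. (h \<bullet> b) ^ \<alpha> b)"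

abbreviation mdeg :: "('a::euclidean_space \<Rightarrow> nat) \<Rightarrow> nat" where
  "mdeg \<alpha> \<equiv> sum \<alpha> Basis"

abbreviation lower :: "('a \<Rightarrow> nat) \<Rightarrow> 'a \<Rightarrow> 'a \<Rightarrow> nat" where
  "lower \<alpha> b \<equiv> \<alpha>(b := \<alpha> b - 1)"

lemma mono_at_bound:
  assumes "norm h \<le> s" shows "\<bar>mono_at \<alpha> h\<bar> \<le> s ^ mdeg \<alpha>"
proof -
  have "\<bar>mono_at \<alpha> h\<bar> = (\<Prod>b\<in>Basis. \<bar>h \<bullet> b\<bar> ^ \<alpha> b)"
    unfolding mono_at_def abs_prod by (simp add: power_abs)
  also have "\<dots> \<le> (\<Prod>b\<in>Basis. s ^ \<alpha> b)"
    using assms by (intro prod_mono) (auto intro!: power_mono intro: order_trans[OF Basis_le_norm])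
  also have "\<dots> = s ^ mdeg \<alpha>" by (simp add: power_sum)
  finally show ?thesis .
qed

lemma mono_at_has_derivative:
  "(mono_at \<alpha> has_derivative (\<lambda>h. \<Sum>b\<in>Basis. (h \<bullet> b) * (\<alpha> b * mono_at (lower \<alpha> b) y))) (at y)"
proof -
  have "mono_at (lower \<alpha> b) y = (y \<bullet> b) ^ (\<alpha> b - 1) * (\<Prod>i\<in>Basis - {b}. (y \<bullet> i) ^ \<alpha> i)"
    if "b \<in> Basis" for b
    unfolding mono_at_def using that
    by (subst prod.remove[of _ b]) (auto intro!: prod.cong)
  then show ?thesis
    unfolding mono_at_def[of \<alpha>, abs_def]
    by (intro has_derivative_eq_rhs[OF has_derivative_prod[OF has_derivative_power[OF
          has_derivative_inner_left[OF has_derivative_ident]]]])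
      (auto simp: fun_eq_iff intro!: sum.cong)
qed

text \<open>Halving the radius pays for the exponent that differentiation brings down:
  \<open>m\<close> is at most \<open>2 ^ m\<close>.  Truncated subtraction in the lowered exponent is harmless, since the
  factor in front vanishes when the exponent is \<open>0\<close>.\<close>

lemma lower_bound:
  assumes "s > 0" "b \<in> Basis"
  shows "\<alpha> b * (s / 2) ^ mdeg (lower \<alpha> b) \<le> 2 / s * s ^ mdeg \<alpha>"
proof (cases "\<alpha> b")
  case 0
  then show ?thesis using assms by simp
next
  case (Suc k)
  define m where "m = mdeg (lower \<alpha> b)"
  have m: "mdeg \<alpha> = Suc m"
    using assms Suc unfolding m_def by (simp add: sum.remove[of _ b])
  have "\<alpha> b \<le> mdeg \<alpha>" using assms by (intro member_le_sum) auto
  also have "mdeg \<alpha> \<le> 2 ^ mdeg \<alpha>" by (rule less_imp_le) (rule less_exp)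
  finally have "real (\<alpha> b) \<le> 2 ^ Suc m" unfolding m
    by (metis of_nat_le_iff of_nat_numeral of_nat_power)
  then have "\<alpha> b * (s / 2) ^ m \<le> 2 ^ Suc m * (s / 2) ^ m"
    using assms by (intro mult_right_mono) auto
  also have "\<dots> = 2 / s * s ^ Suc m" using assms by (simp add: field_simps)
  finally show ?thesis unfolding m m_def .
qed

text \<open>The multi-indices are listed by a sequence that need not be injective.  Differentiating
  in a basis direction then changes the exponents and coefficients in place, with no reindexing of
  the sum, so the notion is closed under partial derivatives by construction.\<close>

definition power_series_at :: "('a::euclidean_space \<Rightarrow> 'b::euclidean_space) \<Rightarrow> 'a \<Rightarrow> bool" where
  "power_series_at u x \<longleftrightarrow> (\<exists>s>0. \<exists>a \<alpha>. summable (\<lambda>i::nat. s ^ mdeg (\<alpha> i) * norm (a i)) \<and>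
     (\<forall>y\<in>ball x s. (\<lambda>i. mono_at (\<alpha> i) (y - x) *\<^sub>R a i) sums u y))"

text \<open>Termwise differentiation on the ball of half the radius, where the differentiated
  terms are dominated by a multiple of the original majorant.\<close>

lemma power_series_at_deriv:
  fixes u :: "'a::euclidean_space \<Rightarrow> 'b::euclidean_space"
  assumes "power_series_at u x"
  shows "u differentiable at x"
    and "b \<in> Basis \<Longrightarrow> power_series_at (\<lambda>y. frechet_derivative u (at y) b) x"
proof -
  obtain s a \<alpha> where s: "s > 0" and summ: "summable (\<lambda>i::nat. s ^ mdeg (\<alpha> i) * norm (a i))"
    and u: "\<And>y. y \<in> ball x s \<Longrightarrow> (\<lambda>i. mono_at (\<alpha> i) (y - x) *\<^sub>R a i) sums u y"
    using assms unfolding power_series_at_def by blast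
  define r where "r = s / 2"
  have r: "r > 0" "r \<le> s" using s by (auto simp: r_def)
  define D where "D i y h =
      (\<Sum>b\<in>Basis. (h \<bullet> b) * (\<alpha> i b * mono_at (lower (\<alpha> i) b) (y - x))) *\<^sub>R a i" for i y h
  have coeff: "\<bar>\<alpha> i b * mono_at (lower (\<alpha> i) b) (y - x)\<bar> \<le> 2 / s * s ^ mdeg (\<alpha> i)"
    if "b \<in> Basis" "y \<in> ball x r" for i b y
  proof -
    have "\<bar>mono_at (lower (\<alpha> i) b) (y - x)\<bar> \<le> r ^ mdeg (lower (\<alpha> i) b)"
      using that by (intro mono_at_bound) (auto simp: dist_norm norm_minus_commute)
    then have "\<bar>\<alpha> i b * mono_at (lower (\<alpha> i) b) (y - x)\<bar> \<le> \<alpha> i b * r ^ mdeg (lower (\<alpha> i) b)"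
      by (simp add: abs_mult mult_left_mono)
    also have "\<dots> \<le> 2 / s * s ^ mdeg (\<alpha> i)"
      unfolding r_def using lower_bound[OF s that(1)] .
    finally show ?thesis .
  qed
  define B where "B i = DIM('a) * (2 / s) * (s ^ mdeg (\<alpha> i) * norm (a i))" for i
  have B: "summable B" unfolding B_def by (intro summable_mult summ)
  have bound: "norm (D i y h) \<le> B i * norm h" if y: "y \<in> ball x r" for i y h
  proof -
    have "\<bar>\<Sum>b\<in>Basis. (h \<bullet> b) * (\<alpha> i b * mono_at (lower (\<alpha> i) b) (y - x))\<bar>
        \<le> (\<Sum>b\<in>(Basis::'a set). norm h * (2 / s * s ^ mdeg (\<alpha> i)))"
    proof (intro order_trans[OF sum_abs] sum_mono)
      fix b :: 'a assume b: "b \<in> Basis"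
      show "\<bar>(h \<bullet> b) * (\<alpha> i b * mono_at (lower (\<alpha> i) b) (y - x))\<bar> \<le> norm h * (2 / s * s ^ mdeg (\<alpha> i))"
        unfolding abs_mult[of "h \<bullet> b"] by (intro mult_mono Basis_le_norm[OF b] coeff[OF b y]) auto
    qed
    then have "norm (D i y h) \<le> (\<Sum>b\<in>(Basis::'a set). norm h * (2 / s * s ^ mdeg (\<alpha> i))) * norm (a i)"
      unfolding D_def norm_scaleR by (intro mult_right_mono) auto
    also have "\<dots> = B i * norm h" unfolding B_def by simp
    finally show ?thesis .
  qed
  have der: "(u has_derivative (\<lambda>h. \<Sum>i. D i y h)) (at y)" if "y \<in> ball x r" for y
  proof (rule has_derivative_sums_bounded[OF convex_ball open_ball that B _ bound])
    fix i y
    show "((\<lambda>y. mono_at (\<alpha> i) (y - x) *\<^sub>R a i) has_derivative D i y) (at y)"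
      unfolding D_def
      by (rule has_derivative_compose[OF _ mono_at_has_derivative, THEN has_derivative_scaleR_left,
            of "\<lambda>y. y - x" "\<lambda>h. h"]) (auto intro!: derivative_eq_intros)
    show "(\<lambda>i. mono_at (\<alpha> i) (y - x) *\<^sub>R a i) sums u y" if "y \<in> ball x r"
      using that r(2) by (intro u) auto
  qed auto
  show "u differentiable at x"
    using der[of x] r(1) by (auto intro: differentiableI)
  assume b: "b \<in> Basis"
  have Db: "D i y b = mono_at (lower (\<alpha> i) b) (y - x) *\<^sub>R (\<alpha> i b *\<^sub>R a i)" for i y
    unfolding D_def using b by (simp add: inner_Basis if_distrib[of "\<lambda>x. x * _"] sum.delta cong: if_cong)
  show "power_series_at (\<lambda>y. frechet_derivative u (at y) b) x"
    unfolding power_series_at_def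
  proof (intro exI[of _ r] exI[of _ "\<lambda>i. \<alpha> i b *\<^sub>R a i"] exI[of _ "\<lambda>i. lower (\<alpha> i) b"] conjI ballI r(1))
    have "norm (r ^ mdeg (lower (\<alpha> i) b) * norm (\<alpha> i b *\<^sub>R a i)) \<le> 2 / s * (s ^ mdeg (\<alpha> i) * norm (a i))" for i
      using mult_right_mono[OF lower_bound[OF s b, of "\<alpha> i"], of "norm (a i)"]
      using s by (simp add: r_def mult_ac)
    then show "summable (\<lambda>i. r ^ mdeg (lower (\<alpha> i) b) * norm (\<alpha> i b *\<^sub>R a i))"
      by (rule summable_comparison_test'[OF summable_mult[OF summ], of 0])
    fix y assume y: "y \<in> ball x r"
    have "frechet_derivative u (at y) b = (\<Sum>i. D i y b)"
      using frechet_derivative_at[OF der[OF y]] by metis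
    moreover have "summable (\<lambda>i. D i y b)"
      using bound[OF y] by (intro summable_norm_cancel[OF summable_comparison_test'[OF summable_mult2[OF B], of 0]]) auto
    ultimately show "(\<lambda>i. mono_at (lower (\<alpha> i) b) (y - x) *\<^sub>R (\<alpha> i b *\<^sub>R a i)) sums frechet_derivative u (at y) b"
      unfolding Db[symmetric] by (simp add: summable_sums)
  qed
qed

lemma summable_norm_if_has_sum_enum:
  fixes c :: "'i \<Rightarrow> 'b::euclidean_space"
  assumes "(c has_sum S) I" "bij_betw e (UNIV::nat set) I"
  shows "summable (\<lambda>i. norm (c (e i)))"
proof -
  have "(\<lambda>i. c (e i)) summable_on UNIV"
    using assms has_sum_reindex_bij_betw[OF assms(2)] has_sum_imp_summable by blast
  then have "(\<lambda>i. c (e i) \<bullet> b) summable_on UNIV" for b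
    using summable_on_bounded_linear[OF bounded_linear_inner_left] by blast
  then have "(\<lambda>i. \<bar>c (e i) \<bullet> b\<bar>) summable_on UNIV" for b
    using summable_on_iff_abs_summable_on_real by fastforce
  then have "summable (\<lambda>i. \<Sum>b\<in>Basis. \<bar>c (e i) \<bullet> b\<bar>)"
    by (intro summable_sum summable_on_imp_summable)
  then show ?thesis
    by (rule summable_comparison_test'[where N=0]) (simp add: norm_le_l1)
qed

text \<open>Unconditional convergence at the point displaced from the centre by the same amount
  \<open>s\<close> in every basis direction is absolute convergence of the series with the monomials replaced by
  powers of \<open>s\<close>, which is the required majorant.\<close>

lemma real_analytic_power_series_at:
  fixes u :: "'a::euclidean_space \<Rightarrow> 'b::euclidean_space"
  assumes "real_analytic u" shows "power_series_at u x"
proof -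
  define I where "I = (Basis :: 'a set) \<rightarrow>\<^sub>E (UNIV :: nat set)"
  obtain r c where r: "r > 0" and
    c: "\<And>y. y \<in> ball x r \<Longrightarrow> ((\<lambda>\<alpha>. mono_at \<alpha> (y - x) *\<^sub>R c \<alpha>) has_sum u y) I"
    using assms unfolding real_analytic_def mono_at_def I_def by blast
  have "countable I" unfolding I_def by (intro countable_PiE) auto
  moreover have "infinite I"
    unfolding I_def using nonempty_Basis by (simp add: finite_PiE_iff PiE_eq_empty_iff)
  ultimately obtain e where e: "bij_betw e (UNIV::nat set) I" by (rule countable_infiniteE')
  define d where "d = (\<Sum>b\<in>(Basis::'a set). b)"
  \<comment> \<open>small enough for \<open>x + s *\<^sub>R d\<close> to lie in the ball of convergence\<close>
  define s where "s = r / (2 * (1 + norm d))"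
  have s: "s > 0" "s \<le> r"
    using r frac_le[of r r 1 "2 * (1 + norm d)"] by (auto simp: s_def intro!: divide_pos_pos add_pos_nonneg)
  have "s * norm d < r"
  proof -
    have "s * norm d \<le> s * (1 + norm d)" using s(1) by (intro mult_left_mono) auto
    also have "\<dots> = r / 2"
      using add_pos_nonneg[of 1 "norm d"] by (simp add: s_def field_simps)
    finally show ?thesis using r by simp
  qed
  then have "x + s *\<^sub>R d \<in> ball x r" using s by (simp add: dist_norm)
  from c[OF this] have "((\<lambda>\<alpha>. mono_at \<alpha> (s *\<^sub>R d) *\<^sub>R c \<alpha>) has_sum u (x + s *\<^sub>R d)) I" by simp
  moreover have "mono_at \<alpha> (s *\<^sub>R d) = s ^ mdeg \<alpha>" for \<alpha>
    unfolding mono_at_def d_def by (simp add: inner_sum_left inner_Basis sum.delta power_sum cong: if_cong)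
  ultimately have "((\<lambda>\<alpha>. s ^ mdeg \<alpha> *\<^sub>R c \<alpha>) has_sum u (x + s *\<^sub>R d)) I" by simp
  from summable_norm_if_has_sum_enum[OF this e]
  have "summable (\<lambda>i. s ^ mdeg (e i) * norm (c (e i)))" using s(1) by simp
  moreover have "(\<lambda>i. mono_at (e i) (y - x) *\<^sub>R c (e i)) sums u y" if "y \<in> ball x s" for y
    using c[of y] that s(2)
    by (intro has_sum_imp_sums iffD2[OF has_sum_reindex_bij_betw[OF e,
          where f = "\<lambda>\<alpha>. mono_at \<alpha> (y - x) *\<^sub>R c \<alpha>"]]) auto
  ultimately show ?thesis
    unfolding power_series_at_def using s(1)
    by (intro exI[of _ s] exI[of _ "\<lambda>i. c (e i)"] exI[of _ e] conjI) auto
qed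

text \<open>A coinductive definition turns closure properties into one differentiation step each.\<close>

coinductive smooth :: "('a::euclidean_space \<Rightarrow> 'b::euclidean_space) \<Rightarrow> bool" where
  smoothI: "(\<And>x. u differentiable at x) \<Longrightarrow>
    (\<And>b. b \<in> Basis \<Longrightarrow> smooth (\<lambda>x. frechet_derivative u (at x) b)) \<Longrightarrow> smooth u"

lemma smooth_differentiable: "smooth u \<Longrightarrow> u differentiable at x"
  by (erule smooth.cases) simp

lemma smooth_partial: "smooth u \<Longrightarrow> b \<in> Basis \<Longrightarrow> smooth (\<lambda>x. frechet_derivative u (at x) b)"
  by (erule smooth.cases) simp

lemma real_analytic_smooth:
  assumes "real_analytic u" shows "smooth u"
proof -
  have "\<forall>x. power_series_at u x" using real_analytic_power_series_at[OF assms] ..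
  then show ?thesis
    by (coinduction arbitrary: u) (auto intro: power_series_at_deriv)
qed

lemma smooth_add:
  fixes u w :: "'a::euclidean_space \<Rightarrow> 'b::euclidean_space"
  assumes "smooth u" "smooth w" shows "smooth (\<lambda>x. u x + w x)"
proof (rule smooth.coinduct[where X = "\<lambda>s. \<exists>u w. smooth u \<and> smooth w \<and> s = (\<lambda>x. u x + w x)"])
  show "\<exists>u' w'. smooth u' \<and> smooth w' \<and> (\<lambda>x. u x + w x) = (\<lambda>x. u' x + w' x)"
    using assms by blast
next
  fix s :: "'a \<Rightarrow> 'b" assume "\<exists>u w. smooth u \<and> smooth w \<and> s = (\<lambda>x. u x + w x)"
  then obtain u w where uw: "smooth u" "smooth w" and s: "s = (\<lambda>x. u x + w x)" by blast
  have d: "(s has_derivative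
      (\<lambda>h. frechet_derivative u (at x) h + frechet_derivative w (at x) h)) (at x)" for x
    unfolding s using uw
    by (intro has_derivative_add) (auto simp: frechet_derivative_works[symmetric] smooth_differentiable)
  show "\<exists>u. s = u \<and> (\<forall>x. u differentiable at x) \<and>
      (\<forall>b. b \<in> Basis \<longrightarrow> (\<exists>v w. smooth v \<and> smooth w \<and>
        (\<lambda>x. frechet_derivative u (at x) b) = (\<lambda>x. v x + w x)) \<or>
        smooth (\<lambda>x. frechet_derivative u (at x) b))"
  proof (rule exI[of _ s], intro conjI allI impI disjI1 refl)
    show "s differentiable at x" for x using d by (rule differentiableI)
    fix b :: 'a assume b: "b \<in> Basis"
    show "\<exists>v w. smooth v \<and> smooth w \<and> (\<lambda>x. frechet_derivative s (at x) b) = (\<lambda>x. v x + w x)"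
      unfolding frechet_derivative_at[OF d, symmetric]
      by (intro exI[of _ "\<lambda>x. frechet_derivative u (at x) b"]
          exI[of _ "\<lambda>x. frechet_derivative w (at x) b"] conjI refl smooth_partial uw b)
  qed
qed

lemma smooth_linear:
  fixes T :: "'b::euclidean_space \<Rightarrow> 'c::euclidean_space" and u :: "'a::euclidean_space \<Rightarrow> 'b"
  assumes T: "bounded_linear T" and "smooth u" shows "smooth (\<lambda>x. T (u x))"
proof (rule smooth.coinduct[where X = "\<lambda>s. \<exists>u. smooth u \<and> s = (\<lambda>x. T (u x))"])
  show "\<exists>u'. smooth u' \<and> (\<lambda>x. T (u x)) = (\<lambda>x. T (u' x))"
    using assms(2) by blast
next
  fix s :: "'a \<Rightarrow> 'c" assume "\<exists>u. smooth u \<and> s = (\<lambda>x. T (u x))"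
  then obtain u where u: "smooth u" and s: "s = (\<lambda>x. T (u x))" by blast
  have d: "(s has_derivative (\<lambda>h. T (frechet_derivative u (at x) h))) (at x)" for x
    unfolding s using u
    by (intro bounded_linear.has_derivative[OF T])
      (auto simp: frechet_derivative_works[symmetric] smooth_differentiable)
  show "\<exists>u. s = u \<and> (\<forall>x. u differentiable at x) \<and>
      (\<forall>b. b \<in> Basis \<longrightarrow> (\<exists>v. smooth v \<and> (\<lambda>x. frechet_derivative u (at x) b) = (\<lambda>x. T (v x))) \<or>
        smooth (\<lambda>x. frechet_derivative u (at x) b))"
  proof (rule exI[of _ s], intro conjI allI impI disjI1 refl)
    show "s differentiable at x" for x using d by (rule differentiableI)
    fix b :: 'a assume b: "b \<in> Basis"
    show "\<exists>v. smooth v \<and> (\<lambda>x. frechet_derivative s (at x) b) = (\<lambda>x. T (v x))"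
      using smooth_partial[OF u b]
      unfolding frechet_derivative_at[OF d, symmetric] by blast
  qed
qed

lemma smooth_zero: "smooth (\<lambda>x. 0)"
  by (rule smooth.coinduct[where X = "\<lambda>s. s = (\<lambda>x. 0)"]) auto

lemma smooth_sum:
  assumes "\<And>i. i \<in> I \<Longrightarrow> smooth (u i)" shows "smooth (\<lambda>x. \<Sum>i\<in>I. u i x)"
  using assms by (induction I rule: infinite_finite_induct) (auto intro: smooth_zero smooth_add)

text \<open>The rows of the transposed Jacobian are the partial derivatives.\<close>

lemma smooth_transpose_jacobian:
  fixes g :: "real^'n \<Rightarrow> real^'l"
  assumes "smooth g" shows "smooth (\<lambda>x. transpose (jacobian g (at x)))"
proof -
  have "transpose (jacobian g (at x)) =
      (\<Sum>j\<in>UNIV. axis j (frechet_derivative g (at x) (axis j 1)))" for x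
    by (simp add: vec_eq_iff transpose_def jacobian_def matrix_def axis_def if_distrib[of "\<lambda>v. v $ _"] sum.delta cong: if_cong)
  moreover have "bounded_linear (axis j :: real^'l \<Rightarrow> _)" for j :: 'n
    by (auto intro!: linear_conv_bounded_linear[THEN iffD1] linearI simp: vec_eq_iff axis_def)
  ultimately show ?thesis
    by (simp, intro smooth_sum smooth_linear[where T = "axis _"] smooth_partial assms) auto
qed


section \<open>Scaling of Adomian polynomials\<close>

text \<open>A class of functions of a base point \<open>x\<close> and a parameter \<open>\<mu>\<close> that contains all derivatives
  in \<open>\<mu>\<close> of \<open>u (x + c \<mu>)\<close> with smooth \<open>u\<close>.  For a polynomial curve \<open>c\<close> the chain rule produces only
  polynomial factors and partial derivatives of \<open>u\<close>, so the class is closed under this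
  differentiation while its members stay differentiable in the base point.  The first fact gives
  the iterated derivatives in Adomian polynomials, the second the Jacobian in the zeroth argument.\<close>

inductive jet :: "(real \<Rightarrow> 'a::euclidean_space) \<Rightarrow> ('a \<Rightarrow> real \<Rightarrow> 'b::euclidean_space) \<Rightarrow> bool"
  for c where
  smooth: "smooth u \<Longrightarrow> jet c (\<lambda>x \<mu>. u (x + c \<mu>))"
| scale: "jet c h \<Longrightarrow> polynomial_function q \<Longrightarrow> jet c (\<lambda>x \<mu>. q \<mu> *\<^sub>R h x \<mu>)"
| add: "jet c h1 \<Longrightarrow> jet c h2 \<Longrightarrow> jet c (\<lambda>x \<mu>. h1 x \<mu> + h2 x \<mu>)"

lemma jet_sum:
  assumes "\<And>i. i \<in> I \<Longrightarrow> jet c (h i)" shows "jet c (\<lambda>x \<mu>. \<Sum>i\<in>I. h i x \<mu>)"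
  using assms
proof (induction I rule: infinite_finite_induct)
  case (insert i I)
  then show ?case by (simp add: jet.add)
qed (use jet.smooth[OF smooth_zero, of c] in simp_all)

lemma jet_deriv:
  assumes c: "polynomial_function c" and "jet c h"
  shows "\<exists>h'. jet c h' \<and> (\<forall>x \<mu>. (h x has_vector_derivative h' x \<mu>) (at \<mu>))"
  using assms(2)
proof induction
  case (smooth u)
  obtain c' where c': "polynomial_function c'" "\<And>\<mu>. (c has_vector_derivative c' \<mu>) (at \<mu>)"
    using has_vector_derivative_polynomial_function[OF c] by blast
  define h' where "h' x \<mu> = (\<Sum>b\<in>Basis. (c' \<mu> \<bullet> b) *\<^sub>R frechet_derivative u (at (x + c \<mu>)) b)" for x \<mu>
  have "jet c h'"
    unfolding h'_def [abs_def]
  proof (intro jet_sum jet.scale jet.smooth[where u = "\<lambda>y. frechet_derivative u (at y) _"] smooth_partial[OF smooth])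
    show "polynomial_function (\<lambda>\<mu>. c' \<mu> \<bullet> b)" for b
      using c'(1) by (intro polynomial_function_inner) auto
  qed
  moreover have "((\<lambda>\<mu>. u (x + c \<mu>)) has_vector_derivative h' x \<mu>) (at \<mu>)" for x \<mu>
  proof -
    have u': "(u has_derivative frechet_derivative u (at (x + c \<mu>))) (at (x + c \<mu>))"
      using smooth_differentiable[OF smooth] by (simp add: frechet_derivative_works[symmetric])
    have l: "linear (frechet_derivative u (at (x + c \<mu>)))"
      using u' by (rule has_derivative_linear)
    have "((\<lambda>\<mu>. x + c \<mu>) has_vector_derivative c' \<mu>) (at \<mu>)"
      using c'(2) by (auto intro!: derivative_eq_intros)
    then have "((\<lambda>\<mu>. u (x + c \<mu>)) has_vector_derivative frechet_derivative u (at (x + c \<mu>)) (c' \<mu>)) (at \<mu>)"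
      using vector_derivative_diff_chain_within[of "\<lambda>\<mu>. x + c \<mu>" "c' \<mu>" \<mu> UNIV u] u'
      by (simp add: o_def has_derivative_at_withinI)
    moreover have "frechet_derivative u (at (x + c \<mu>)) (c' \<mu>) = h' x \<mu>"
      unfolding h'_def
      by (subst (1) euclidean_representation[of "c' \<mu>", symmetric])
        (simp add: linear_sum[OF l] linear_scale[OF l])
    ultimately show ?thesis by simp
  qed
  ultimately show ?case by blast
next
  case (scale h q)
  obtain q' where q': "polynomial_function q'" "\<And>\<mu>. (q has_vector_derivative q' \<mu>) (at \<mu>)"
    using has_vector_derivative_polynomial_function[OF scale.hyps(2)] by blast
  obtain h' where h': "jet c h'" "\<And>x \<mu>. (h x has_vector_derivative h' x \<mu>) (at \<mu>)"
    using scale.IH by blast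
  have "((\<lambda>\<mu>. q \<mu> *\<^sub>R h x \<mu>) has_vector_derivative q \<mu> *\<^sub>R h' x \<mu> + q' \<mu> *\<^sub>R h x \<mu>) (at \<mu>)" for x \<mu>
    using q'(2) h'(2) by (intro has_vector_derivative_scaleR) (simp_all add: has_real_derivative_iff_has_vector_derivative)
  moreover have "jet c (\<lambda>x \<mu>. q \<mu> *\<^sub>R h' x \<mu> + q' \<mu> *\<^sub>R h x \<mu>)"
    using h'(1) q'(1) scale.hyps by (intro jet.add jet.scale)
  ultimately show ?case by blast
next
  case (add h1 h2)
  obtain h1' h2' where "jet c h1'" "\<And>x \<mu>. (h1 x has_vector_derivative h1' x \<mu>) (at \<mu>)"
      "jet c h2'" "\<And>x \<mu>. (h2 x has_vector_derivative h2' x \<mu>) (at \<mu>)"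
    using add.IH by blast
  then show ?case
    by (intro exI[of _ "\<lambda>x \<mu>. h1' x \<mu> + h2' x \<mu>"] conjI jet.add allI has_vector_derivative_add)
qed

abbreviation vd :: "(real \<Rightarrow> 'a::real_normed_vector) \<Rightarrow> real \<Rightarrow> 'a" where
  "vd h x \<equiv> vector_derivative h (at x)"

lemma jet_iterated_deriv:
  assumes "polynomial_function c" and "jet c h"
  shows "\<exists>h'. jet c h' \<and> (\<forall>x. (vd ^^ k) (h x) = h' x)"
proof (induction k)
  case 0
  then show ?case using assms(2) by auto
next
  case (Suc k)
  then obtain h1 where h1: "jet c h1" "\<And>x. (vd ^^ k) (h x) = h1 x" by blast
  obtain h2 where h2: "jet c h2" "\<And>x \<mu>. (h1 x has_vector_derivative h2 x \<mu>) (at \<mu>)"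
    using jet_deriv[OF assms(1) h1(1)] by blast
  have "(vd ^^ Suc k) (h x) = h2 x" for x
    using h2(2) by (simp add: h1(2) fun_eq_iff vector_derivative_at)
  then show ?case using h2(1) by blast
qed

lemma jet_differentiable:
  assumes "jet c h" shows "(\<lambda>x. h x \<mu>) differentiable at y"
  using assms
proof induction
  case (smooth u)
  then show ?case
    using differentiable_chain_at[of "\<lambda>x. x + c \<mu>" y u] smooth_differentiable by (auto simp: o_def)
qed auto

text \<open>Differentiability everywhere is essential here: \<open>vector_derivative\<close> is an arbitrary
  value at a point of non-differentiability, and such a value would not scale.\<close>

lemma iterated_deriv_scaled:
  fixes h :: "real \<Rightarrow> 'a::euclidean_space"
  assumes "\<And>k \<mu>. (vd ^^ k) h differentiable at \<mu>"
  shows "(vd ^^ k) (\<lambda>\<mu>. h (t * \<mu>)) = (\<lambda>\<mu>. t ^ k *\<^sub>R (vd ^^ k) h (t * \<mu>))"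
proof (induction k)
  case (Suc k)
  define H where "H = (vd ^^ k) h"
  have "(H has_vector_derivative vd H (t * \<mu>)) (at (t * \<mu>))" for \<mu>
    unfolding H_def using assms vector_derivative_works by blast
  moreover have "((*) t has_vector_derivative t) (at \<mu>)" for \<mu>
    by (auto intro!: derivative_eq_intros simp: has_real_derivative_iff_has_vector_derivative[symmetric])
  ultimately have "((\<lambda>\<mu>. H (t * \<mu>)) has_vector_derivative t *\<^sub>R vd H (t * \<mu>)) (at \<mu>)" for \<mu>
    using vector_diff_chain_at[of "\<lambda>\<mu>. t * \<mu>" t \<mu> H] by (simp add: o_def)
  then have "((\<lambda>\<mu>. t ^ k *\<^sub>R H (t * \<mu>)) has_vector_derivative t ^ k *\<^sub>R t *\<^sub>R vd H (t * \<mu>)) (at \<mu>)" for \<mu>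
    by (intro bounded_linear.has_vector_derivative[OF bounded_linear_scaleR_right])
  then have "vd (\<lambda>\<mu>. t ^ k *\<^sub>R H (t * \<mu>)) \<mu> = t ^ k *\<^sub>R t *\<^sub>R vd H (t * \<mu>)" for \<mu>
    by (rule vector_derivative_at)
  then show ?case
    unfolding funpow.simps o_apply Suc by (simp add: H_def fun_eq_iff mult.commute[of "t ^ k" t])
qed simp

definition tail_curve :: "(nat \<Rightarrow> 'a::euclidean_space) \<Rightarrow> nat \<Rightarrow> real \<Rightarrow> 'a" where
  "tail_curve w k \<mu> = (\<Sum>i=1..k. \<mu> ^ i *\<^sub>R w i)"

lemma polynomial_tail_curve: "polynomial_function (tail_curve w k)"
proof -
  have "real_polynomial_function (\<lambda>\<mu>::real. \<mu> ^ i)" for i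
    by (intro real_polynomial_function_power) (simp add: real_polynomial_function.intros(1))
  then show ?thesis
    unfolding tail_curve_def[abs_def]
    by (intro polynomial_function_sum polynomial_function_mult)
      (auto simp: real_polynomial_function_eq[symmetric])
qed

lemma curve_split: "(\<Sum>i\<le>k. \<mu> ^ i *\<^sub>R w i) = w 0 + tail_curve w k \<mu>"
  unfolding tail_curve_def atMost_atLeast0 by (simp add: sum.atLeast_Suc_atMost)

text \<open>Weighted homogeneity: giving \<open>w i\<close> the weight \<open>i\<close>, the curve through the scaled values is
  the original curve run at speed \<open>t\<close>, so its \<open>k\<close>-th derivative at \<open>0\<close> gains the factor \<open>t ^ k\<close>.
  The case \<open>t = 0\<close> is included, with \<open>0 ^ 0 = 1\<close>.\<close>

lemma adomian_scaled:
  assumes N: "smooth N" and w: "\<And>i. i \<le> k \<Longrightarrow> w i = t ^ i *\<^sub>R c i"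
  shows "adomian N w k = t ^ k *\<^sub>R adomian N c k"
proof -
  define h where "h = (\<lambda>\<mu>. N (\<Sum>i\<le>k. \<mu> ^ i *\<^sub>R c i))"
  have "(vd ^^ m) h differentiable at \<mu>" for m \<mu>
  proof -
    obtain h1 where h1: "jet (tail_curve c k) h1" "(vd ^^ m) h = h1 (c 0)"
      using jet_iterated_deriv[OF polynomial_tail_curve jet.smooth[OF N]]
      unfolding h_def curve_split by blast
    show ?thesis
      unfolding h1(2) using jet_deriv[OF polynomial_tail_curve h1(1)]
      by (auto intro: differentiableI_vector)
  qed
  note * = iterated_deriv_scaled[OF this, of k t]
  have "(\<lambda>\<mu>. N (\<Sum>i\<le>k. \<mu> ^ i *\<^sub>R w i)) = (\<lambda>\<mu>. h (t * \<mu>))"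
    unfolding h_def by (simp add: w power_mult_distrib mult.commute)
  then have "adomian N w k = (1 / fact k) *\<^sub>R (t ^ k *\<^sub>R (vd ^^ k) h (t * 0))"
    unfolding adomian_def by (simp only: *)
  then show ?thesis
    unfolding adomian_def h_def by simp
qed

lemma adomian_differentiable_0:
  assumes "smooth N" shows "(\<lambda>x. adomian N (w(0 := x)) k) differentiable at y"
proof -
  have tail: "tail_curve (w(0 := x)) k = tail_curve w k" for x
    unfolding tail_curve_def by (auto intro!: sum.cong)
  obtain h where h: "jet (tail_curve w k) h"
    "\<And>x. (vd ^^ k) (\<lambda>\<mu>. N (x + tail_curve w k \<mu>)) = h x"
    using jet_iterated_deriv[OF polynomial_tail_curve jet.smooth[OF assms]] by blast
  have "adomian N (w(0 := x)) k = (1 / fact k) *\<^sub>R h x 0" for x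
    unfolding adomian_def curve_split tail by (simp add: h(2))
  then show ?thesis using jet_differentiable[OF h(1)] by auto
qed

lemma adomian_jac0_scaled:
  assumes g: "smooth g" and w: "\<And>i. i \<le> k \<Longrightarrow> w i = t ^ i *\<^sub>R c i"
  shows "adomian_jac0 g w k = t ^ k *\<^sub>R adomian_jac0 g c k"
proof -
  define F where "F = (\<lambda>x. adomian g (c(0 := x)) k)"
  have F: "(\<lambda>x. adomian g (w(0 := x)) k) = (\<lambda>x. t ^ k *\<^sub>R F x)"
    unfolding F_def by (intro ext adomian_scaled[OF g]) (use w in auto)
  have w0: "w 0 = c 0" using w[of 0] by simp
  have "(F has_derivative frechet_derivative F (at (c 0))) (at (c 0))"
    using adomian_differentiable_0[OF g] by (simp add: F_def frechet_derivative_works[symmetric])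
  then have "((\<lambda>x. t ^ k *\<^sub>R F x) has_derivative (\<lambda>h. t ^ k *\<^sub>R frechet_derivative F (at (c 0)) h)) (at (c 0))"
    by (rule has_derivative_scaleR_right)
  note frechet_derivative_at[OF this, symmetric]
  then show ?thesis
    unfolding adomian_jac0_def jacobian_def F w0 F_def[symmetric]
    by (simp add: vec_eq_iff matrix_def)
qed

section \<open>Monomials in time\<close>

lemma trivial_limit_at_within_atLeast: "t \<ge> 0 \<Longrightarrow> at t within {0::real..} \<noteq> bot"
proof -
  assume "t \<ge> 0"
  moreover have "{0::real..} \<noteq> {a}" for a
    using atLeast_eq_iff by (metis atLeast_iff add_increasing2 less_add_one less_irrefl order_refl singletonD zero_le_one)
  ultimately show ?thesis
    unfolding trivial_limit_within by (simp add: connected_imp_perfect)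
qed

text \<open>Monomials of degree \<open>k\<close> on the time axis \<open>t \<ge> 0\<close>; the coefficient is the value at
  \<open>t = 1\<close>.\<close>

definition homog :: "nat \<Rightarrow> (real \<Rightarrow> 'a::euclidean_space) \<Rightarrow> bool" where
  "homog k x \<longleftrightarrow> (\<forall>t\<ge>0. x t = t ^ k *\<^sub>R x 1)"

lemma homogI: "(\<And>t. t \<ge> 0 \<Longrightarrow> x t = t ^ k *\<^sub>R c) \<Longrightarrow> homog k x"
proof -
  assume x: "\<And>t. t \<ge> 0 \<Longrightarrow> x t = t ^ k *\<^sub>R c"
  then have "x 1 = c" by simp
  with x show ?thesis by (simp add: homog_def)
qed

lemma homogD: "homog k x \<Longrightarrow> t \<ge> 0 \<Longrightarrow> x t = t ^ k *\<^sub>R x 1"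
  unfolding homog_def by blast

lemma homog_cong: "(\<And>t. t \<ge> 0 \<Longrightarrow> x t = y t) \<Longrightarrow> homog k x \<longleftrightarrow> homog k y"
  unfolding homog_def by simp

lemma monomial_has_vector_derivative:
  "((\<lambda>t. t ^ k *\<^sub>R c) has_vector_derivative (real k * t ^ (k - 1)) *\<^sub>R c) (at t within S)"
proof -
  have "((\<lambda>t. t ^ k) has_real_derivative real k * t ^ (k - 1)) (at t within S)"
    by (auto intro!: derivative_eq_intros)
  from has_vector_derivative_scaleR[OF this has_vector_derivative_const] show ?thesis by simp
qed

lemma homog_has_vector_derivative:
  assumes "homog k x" "t \<ge> 0"
  shows "(x has_vector_derivative (real k * t ^ (k - 1)) *\<^sub>R x 1) (at t within {0..})"
proof (rule has_vector_derivative_transform)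
  show "((\<lambda>t. t ^ k *\<^sub>R x 1) has_vector_derivative (real k * t ^ (k - 1)) *\<^sub>R x 1) (at t within {0..})"
    by (rule monomial_has_vector_derivative)
qed (use assms homogD in auto)

lemma Lop_eqI:
  assumes "(x has_vector_derivative d) (at t within {0..})" "t \<ge> 0"
  shows "Lop x t = d"
  unfolding Lop_def using trivial_limit_at_within_atLeast[OF assms(2)] assms(1)
  by (rule vector_derivative_within)

lemma Lop_homog:
  assumes "homog k x" "t \<ge> 0" shows "Lop x t = (real k * t ^ (k - 1)) *\<^sub>R x 1"
  using Lop_eqI[OF homog_has_vector_derivative[OF assms] assms(2)] .

lemma homog_Lop: "homog k x \<Longrightarrow> homog (k - 1) (Lop x)"
  by (rule homogI[where c = "real k *\<^sub>R x 1"]) (simp add: Lop_homog)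

lemma homog_differentiable_on: "homog k x \<Longrightarrow> x differentiable_on {0..}"
  unfolding differentiable_on_def
  by (auto intro!: differentiableI_vector homog_has_vector_derivative)

lemma homog_continuous_on: "homog k x \<Longrightarrow> continuous_on {0..} x"
  by (intro differentiable_imp_continuous_on homog_differentiable_on)

lemma Lop_cong:
  assumes "\<And>t. t \<ge> 0 \<Longrightarrow> x t = y t" "t \<ge> 0" shows "Lop x t = Lop y t"
  unfolding Lop_def vector_derivative_def using assms
  by (intro arg_cong[where f = Eps] ext iffI) (auto elim!: has_vector_derivative_transform[rotated 2])

lemma Linv_cong:
  assumes "\<And>t. t \<ge> 0 \<Longrightarrow> x t = y t" shows "Linv x t = Linv y t"
  unfolding Linv_def using assms by (intro Henstock_Kurzweil_Integration.integral_cong) auto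

lemma Linv_has_vector_derivative:
  assumes "continuous_on {0..} x" "t \<ge> 0"
  shows "(Linv x has_vector_derivative x t) (at t within {0..})"
proof -
  have "((\<lambda>u. integral {0..u} x) has_vector_derivative x t) (at t within {0..t+1})"
    using assms by (intro integral_has_vector_derivative continuous_on_subset[OF assms(1)]) auto
  moreover have "at t within {0..t+1} = at t within {0..}"
    by (rule at_within_nhd[of _ "{..<t+1}"]) auto
  ultimately show ?thesis by (simp add: Linv_def[abs_def])
qed

lemma Lop_Linv: "continuous_on {0..} x \<Longrightarrow> t \<ge> 0 \<Longrightarrow> Lop (Linv x) t = x t"
  by (intro Lop_eqI Linv_has_vector_derivative)

lemma continuous_on_Linv: "continuous_on {0..} x \<Longrightarrow> continuous_on {0..} (Linv x)"
  by (intro differentiable_imp_continuous_on)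
    (auto simp: differentiable_on_def intro!: differentiableI_vector Linv_has_vector_derivative)

text \<open>The reason why a continuous multiplier is determined by its twofold integral.\<close>

lemma Lop_Lop_Linv_Linv:
  assumes "continuous_on {0..} x" "t \<ge> 0"
  shows "Lop (Lop (Linv (Linv x))) t = x t"
  using assms by (subst Lop_cong[of _ "Linv x"]) (auto intro: Lop_Linv continuous_on_Linv)

lemma Linv_homog:
  assumes "homog k x" "t \<ge> 0" shows "Linv x t = (t ^ Suc k / real (Suc k)) *\<^sub>R x 1"
proof -
  have "(x has_integral (t ^ Suc k / real (Suc k)) *\<^sub>R x 1 - (0 ^ Suc k / real (Suc k)) *\<^sub>R x 1) {0..t}"
  proof (rule fundamental_theorem_of_calculus[OF assms(2)])
    fix s assume s: "s \<in> {0..t}"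
    have "((\<lambda>t. (t ^ Suc k / real (Suc k)) *\<^sub>R x 1) has_vector_derivative s ^ k *\<^sub>R x 1) (at s within {0..t})"
      using monomial_has_vector_derivative[of "Suc k" "(1 / real (Suc k)) *\<^sub>R x 1" s "{0..t}"] by simp
    then show "((\<lambda>t. (t ^ Suc k / real (Suc k)) *\<^sub>R x 1) has_vector_derivative x s) (at s within {0..t})"
      using homogD[OF assms(1), of s] s by simp
  qed
  then show ?thesis unfolding Linv_def by (simp add: integral_unique)
qed

lemma homog_Linv: "homog k x \<Longrightarrow> homog (Suc k) (Linv x)"
  by (rule homogI[where c = "(1 / real (Suc k)) *\<^sub>R x 1"]) (simp add: Linv_homog)

lemma Linv_Lop:
  assumes "homog (Suc k) x" "t \<ge> 0" shows "Linv (Lop x) t = x t"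
  using Linv_homog[OF homog_Lop[OF assms(1), simplified] assms(2)] Lop_homog[OF assms(1), of 1]
    homogD[OF assms]
  by simp

text \<open>A monomial of degree at least two vanishes at \<open>0\<close> together with its first derivative, so
  nothing is lost by differentiating twice and integrating back.\<close>

lemma Linv_Linv_Lop_Lop:
  assumes "homog n x" "n \<ge> 2" "t \<ge> 0" shows "Linv (Linv (Lop (Lop x))) t = x t"
proof -
  define k where "k = n - 2"
  have n: "n = Suc (Suc k)" using assms(2) by (simp add: k_def)
  have "homog (Suc k) (Lop x)" using homog_Lop[OF assms(1)] by (simp add: n)
  then have "Linv (Linv (Lop (Lop x))) t = Linv (Lop x) t" by (intro Linv_cong Linv_Lop)
  also have "\<dots> = x t" using assms by (intro Linv_Lop) (auto simp: n)
  finally show ?thesis .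
qed

lemma homog_matrix:
  fixes A :: "real^'n^'m"
  assumes "homog k x" shows "homog k (\<lambda>t. A *v x t)"
proof (rule homogI)
  fix t :: real assume "t \<ge> 0"
  from homogD[OF assms this] have "A *v x t = A *v (t ^ k *\<^sub>R x 1)" by (rule arg_cong)
  then show "A *v x t = t ^ k *\<^sub>R (A *v x 1)" by (simp only: matrix_vector_mult_scaleR)
qed

lemma homog_add:
  assumes "homog k x" "homog k y" shows "homog k (\<lambda>t. x t + y t)"
proof (rule homogI)
  fix t :: real assume "t \<ge> 0"
  from arg_cong2[OF homogD[OF assms(1) this] homogD[OF assms(2) this], of "(+)"]
  show "x t + y t = t ^ k *\<^sub>R (x 1 + y 1)" by (simp only: scaleR_add_right)
qed

lemma homog_uminus:
  assumes "homog k x" shows "homog k (\<lambda>t. - x t)"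
proof (rule homogI)
  fix t :: real assume "t \<ge> 0"
  from arg_cong[OF homogD[OF assms this], of uminus]
  show "- x t = t ^ k *\<^sub>R (- x 1)" by (simp only: scaleR_minus_right)
qed

lemma homog_diff: "homog k x \<Longrightarrow> homog k y \<Longrightarrow> homog k (\<lambda>t. x t - y t)"
  using homog_add[of k x "\<lambda>t. - y t"] homog_uminus[of k y] by simp

lemma homog_sum:
  assumes "\<And>i. i \<in> I \<Longrightarrow> homog k (x i)" shows "homog k (\<lambda>t. \<Sum>i\<in>I. x i t)"
  using assms
  by (induction I rule: infinite_finite_induct) (auto intro: homog_add simp: homog_def[of k "\<lambda>t. 0"])

lemma homog_scaleR:
  assumes "homog k x" shows "homog k (\<lambda>t. c *\<^sub>R x t)"
proof (rule homogI)
  fix t :: real assume "t \<ge> 0"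
  from arg_cong[OF homogD[OF assms this], of "scaleR c"]
  show "c *\<^sub>R x t = t ^ k *\<^sub>R (c *\<^sub>R x 1)" by (simp only: scaleR_scaleR mult.commute)
qed

lemma homog_matrix_vector_mult:
  assumes "homog j (A :: real \<Rightarrow> real^'n^'m)" "homog k x" "i = j + k"
  shows "homog i (\<lambda>t. A t *v x t)"
proof (rule homogI)
  fix t :: real assume "t \<ge> 0"
  from arg_cong2[OF homogD[OF assms(1) this] homogD[OF assms(2) this], of "(*v)"]
  have "A t *v x t = (t ^ j *\<^sub>R A 1) *v (t ^ k *\<^sub>R x 1)" .
  also have "\<dots> = t ^ i *\<^sub>R (A 1 *v x 1)"
    unfolding matrix_vector_mult_scaleR scaleR_matrix_vector_assoc[symmetric] scaleR_scaleR
    by (simp only: assms(3) power_add mult.commute)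
  finally show "A t *v x t = t ^ i *\<^sub>R (A 1 *v x 1)" .
qed

lemma Lop_matrix:
  fixes A :: "real^'n^'m"
  assumes "homog k x" "t \<ge> 0" shows "Lop (\<lambda>t. A *v x t) t = A *v Lop x t"
  using Lop_homog[OF homog_matrix[OF assms(1)] assms(2)] Lop_homog[OF assms]
  by (simp add: matrix_vector_mult_scaleR)

lemma Lop_diff:
  assumes "homog k x" "homog k y" "t \<ge> 0" shows "Lop (\<lambda>t. x t - y t) t = Lop x t - Lop y t"
  using Lop_homog[OF homog_diff[OF assms(1,2)] assms(3)] Lop_homog[OF assms(1,3)] Lop_homog[OF assms(2,3)]
  by (simp add: scaleR_diff_right)

section \<open>The saddle-point system\<close>

lemma pos_def_invertible: "pos_def A \<Longrightarrow> invertible A"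
  unfolding invertible_left_inverse matrix_left_invertible_ker pos_def_def
  by (metis inner_zero_right order.irrefl)

lemma matrix_inv_mult:
  fixes A :: "real^'n^'n"
  assumes "invertible A"
  shows "A *v (matrix_inv A *v x) = x" "matrix_inv A *v (A *v x) = x"
proof -
  have "A ** matrix_inv A = mat 1 \<and> matrix_inv A ** A = mat 1"
    using assms unfolding invertible_def matrix_inv_def by (rule someI_ex)
  then show "A *v (matrix_inv A *v x) = x" "matrix_inv A *v (A *v x) = x"
    by (simp_all add: matrix_vector_mul_assoc)
qed

lemma pos_def_matrix_inv:
  fixes A :: "real^'n^'n"
  assumes "pos_def A" shows "pos_def (matrix_inv A)"
  unfolding pos_def_def
proof (intro allI impI)
  fix y :: "real^'n" assume y: "y \<noteq> 0"
  note inv = matrix_inv_mult[OF pos_def_invertible[OF assms]]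
  have "matrix_inv A *v y \<noteq> 0" using y inv(1)[of y] by auto
  then show "y \<bullet> (matrix_inv A *v y) > 0"
    using assms inv(1)[of y] unfolding pos_def_def by (metis inner_commute)
qed

text \<open>The rank condition makes \<open>transpose G\<close> injective, so the quadratic form of the Schur
  complement is that of the inverse mass matrix at a nonzero vector.\<close>

lemma pos_def_schur:
  fixes G :: "real^'n^'l"
  assumes "pos_def A" "rank G = CARD('l)"
  shows "pos_def (G ** matrix_inv A ** transpose G)"
  unfolding pos_def_def
proof (intro allI impI)
  fix y :: "real^'l" assume y: "y \<noteq> 0"
  have "inj ((*v) (transpose G))"
    using assms(2) full_rank_injective[of "transpose G"] by (simp add: rank_transpose)
  then have "transpose G *v y \<noteq> 0"
    using y by (metis injD matrix_vector_mult_0_right)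
  then have "0 < (transpose G *v y) \<bullet> (matrix_inv A *v (transpose G *v y))"
    using pos_def_matrix_inv[OF assms(1)] unfolding pos_def_def by blast
  also have "\<dots> = y \<bullet> (G ** matrix_inv A ** transpose G *v y)"
    by (simp add: matrix_vector_mul_assoc[symmetric] dot_lmul_matrix[symmetric])
  finally show "y \<bullet> (G ** matrix_inv A ** transpose G *v y) > 0" .
qed

text \<open>Block elimination: solve the first equation for \<open>P\<close> and substitute into the second.\<close>

lemma saddle_system_iff:
  fixes A :: "real^'n^'n" and G :: "real^'n^'l"
  defines "K \<equiv> G ** matrix_inv A ** transpose G"
  assumes A: "invertible A" and K: "invertible K"
  shows "A *v P + transpose G *v \<Lambda> = r \<and> G *v P = s \<longleftrightarrow>
    \<Lambda> = matrix_inv K *v (G *v (matrix_inv A *v r) - s) \<and>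
    P = matrix_inv A *v r - matrix_inv A *v (transpose G *v \<Lambda>)"
    (is "?lhs \<longleftrightarrow> ?rhs")
proof
  have KA: "K *v y = G *v (matrix_inv A *v (transpose G *v y))" for y
    unfolding K_def by (simp add: matrix_vector_mul_assoc[symmetric])
  {
    assume L: ?lhs
    then have "matrix_inv A *v (A *v P + transpose G *v \<Lambda>) = matrix_inv A *v r" by simp
    then have P: "P = matrix_inv A *v r - matrix_inv A *v (transpose G *v \<Lambda>)"
      by (simp add: matrix_vector_right_distrib matrix_inv_mult[OF A] algebra_simps)
    have "K *v \<Lambda> = G *v (matrix_inv A *v r) - s"
      using L arg_cong[OF P, of "(*v) G"]
      by (simp add: KA matrix_vector_mult_diff_distrib algebra_simps)
    then have "\<Lambda> = matrix_inv K *v (G *v (matrix_inv A *v r) - s)"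
      using matrix_inv_mult(2)[OF K, of \<Lambda>] by simp
    then show ?rhs using P by blast
  next
    assume R: ?rhs
    then have P: "P = matrix_inv A *v r - matrix_inv A *v (transpose G *v \<Lambda>)" by blast
    from R have "K *v \<Lambda> = G *v (matrix_inv A *v r) - s"
      by (simp add: matrix_inv_mult(1)[OF K])
    then show ?lhs
      unfolding P by (simp add: KA matrix_vector_mult_diff_distrib matrix_inv_mult[OF A])
  }
qed

section \<open>The right-hand sides as monomials\<close>

lemma homog_adomian:
  fixes w :: "nat \<Rightarrow> real \<Rightarrow> 'a::euclidean_space"
  assumes "smooth N" "\<And>i. i \<le> k \<Longrightarrow> homog i (w i)"
  shows "homog k (\<lambda>t. adomian N (\<lambda>i. w i t) k)"
  by (rule homogI, rule adomian_scaled[OF assms(1)]) (rule homogD[OF assms(2)])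

lemma homog_adomian_jac0:
  assumes "smooth g" "\<And>i. i \<le> k \<Longrightarrow> homog i (w i)"
  shows "homog k (\<lambda>t. adomian_jac0 g (\<lambda>i. w i t) k)"
  by (rule homogI, rule adomian_jac0_scaled[OF assms(1)]) (rule homogD[OF assms(2)])

lemma homog_Pair:
  assumes "homog k x" "homog k y" shows "homog k (\<lambda>t. (x t, y t))"
proof (rule homogI)
  fix t :: real assume "t \<ge> 0"
  from arg_cong2[OF homogD[OF assms(1) this] homogD[OF assms(2) this], of Pair]
  show "(x t, y t) = t ^ k *\<^sub>R (x 1, y 1)" by (simp only: scaleR_Pair)
qed

lemma homog_sysS:
  assumes "smooth g" "\<And>i. i < n \<Longrightarrow> homog i (p i)"
  shows "homog n (sysS g p n)"
proof -
  have "homog n (\<lambda>t. adomian_jac0 g (\<lambda>j. p j t) (n - i) *v p i t)" if "i \<in> {1..n-1}" for i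
    using that assms
    by (intro homog_matrix_vector_mult[OF homog_adomian_jac0, where k = i]) auto
  then show ?thesis
    unfolding sysS_def[abs_def] by (intro homog_uminus homog_scaleR homog_sum)
qed

section \<open>Dependence on earlier iterates only\<close>

lemma adomian_cong: "(\<And>i. i \<le> k \<Longrightarrow> w i = w' i) \<Longrightarrow> adomian N w k = adomian N w' k"
  unfolding adomian_def by simp

lemma adomian_jac0_cong:
  assumes "\<And>i. i \<le> k \<Longrightarrow> w i = w' i" shows "adomian_jac0 g w k = adomian_jac0 g w' k"
proof -
  have "adomian g (w(0 := x)) k = adomian g (w'(0 := x)) k" for x
    using assms by (intro adomian_cong) auto
  then show ?thesis using assms[of 0] by (simp add: adomian_jac0_def)
qed

lemma adomian_rhs_cong:
  fixes p v z p' v' z' :: "nat \<Rightarrow> real \<Rightarrow> real^'n" and lam lam' :: "nat \<Rightarrow> real \<Rightarrow> real^'l"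
  assumes "\<And>i. i \<le> j \<Longrightarrow> p i = p' i \<and> v i = v' i" "\<And>i. i < j \<Longrightarrow> lam i = lam' i \<and> z i = z' i"
  shows "adomian_rhs M f G p v lam z j = adomian_rhs M f G p' v' lam' z' j"
proof
  fix t
  have "adomian f (\<lambda>i. (p i t, v i t)) j = adomian f (\<lambda>i. (p' i t, v' i t)) j"
    using assms by (intro adomian_cong) auto
  moreover have "adomian M (\<lambda>i. p i t) (j - k) = adomian M (\<lambda>i. p' i t) (j - k)"
    "adomian (\<lambda>x. transpose (G x)) (\<lambda>i. p i t) (j - k) =
      adomian (\<lambda>x. transpose (G x)) (\<lambda>i. p' i t) (j - k)" for k
    by (rule adomian_cong; use assms in auto)+
  ultimately show "adomian_rhs M f G p v lam z j t = adomian_rhs M f G p' v' lam' z' j t"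
    unfolding adomian_rhs_def using assms(2) by (auto intro!: sum.cong)
qed

lemma sysS_cong:
  assumes "\<And>i. i < n \<Longrightarrow> p i = p' i" shows "sysS g p n = sysS g p' n"
proof
  fix t
  have "adomian_jac0 g (\<lambda>j. p j t) (n - i) = adomian_jac0 g (\<lambda>j. p' j t) (n - i)" if "i \<in> {1..n-1}" for i
    using assms that by (intro adomian_jac0_cong) auto
  then show "sysS g p n t = sysS g p' n t"
    unfolding sysS_def using assms by (auto intro!: sum.cong)
qed

lemma solves_system_cong:
  assumes "n \<ge> 2" "\<And>i. i < n \<Longrightarrow> p i = p' i" "\<And>i. i + 1 < n \<Longrightarrow> v i = v' i"
    "\<And>i. i + 2 < n \<Longrightarrow> lam i = lam' i \<and> z i = z' i"
  shows "solves_system M f g G p v lam z n P \<Lambda> \<longleftrightarrow> solves_system M f g G p' v' lam' z' n P \<Lambda>"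
proof -
  have "adomian_rhs M f G p v lam z (n - 2) = adomian_rhs M f G p' v' lam' z' (n - 2)"
    using assms by (intro adomian_rhs_cong) auto
  moreover have "sysS g p n = sysS g p' n" using assms by (intro sysS_cong) auto
  moreover have "p 0 = p' 0" using assms by auto
  ultimately show ?thesis unfolding solves_system_def sysR_def by simp
qed

lemma solves_z_cong:
  assumes "\<And>i. i \<le> k \<Longrightarrow> p i = p' i \<and> v i = v' i \<and> lam i = lam' i \<and> z i = z' i"
  shows "solves_z M f G p v lam z k \<longleftrightarrow> solves_z M f G p' v' lam' z' k"
proof -
  have "adomian_rhs M f G p v lam z k = adomian_rhs M f G p' v' lam' z' k"
    using assms by (intro adomian_rhs_cong) auto
  then show ?thesis unfolding solves_z_def using assms[of 0] assms[of k] by simp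
qed

lemma iterates_upto_mono:
  "iterates_upto M f g G p0 v0 N p v lam z \<Longrightarrow> N' \<le> N \<Longrightarrow> iterates_upto M f g G p0 v0 N' p v lam z"
  unfolding iterates_upto_def by auto

lemma iterates_upto_step:
  assumes "n \<ge> 2"
  shows "iterates_upto M f g G p0 v0 n p v lam z \<longleftrightarrow>
    iterates_upto M f g G p0 v0 (n - 1) p v lam z \<and>
       continuous_on {0..} (lam (n - 2)) \<and>
       solves_system M f g G p v lam z n (p n) (Linv (Linv (lam (n - 2)))) \<and>
       p n differentiable_on {0..} \<and> (\<forall>t\<ge>0. v (n - 1) t = Lop (p n) t) \<and>
       solves_z M f G p v lam z (n - 2)"
proof -
  have "2 \<le> m \<and> m \<le> n \<longleftrightarrow> 2 \<le> m \<and> m \<le> n - 1 \<or> m = n" for m using assms by auto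
  then show ?thesis unfolding iterates_upto_def by (simp add: all_conj_distrib imp_conjL disj_imp) blast
qed

text \<open>The scheme up to step \<open>N\<close> sees only the entries constrained by it.  This is what allows
  later entries to be overwritten when the scheme is extended.\<close>

lemma iterates_upto_cong_imp:
  assumes "iterates_upto M f g G p0 v0 N p v lam z" "N \<ge> 1"
    and eq: "\<And>i. i \<le> N \<Longrightarrow> p i = p' i" "\<And>i. i < N \<Longrightarrow> v i = v' i"
      "\<And>i. i + 2 \<le> N \<Longrightarrow> lam i = lam' i \<and> z i = z' i"
  shows "iterates_upto M f g G p0 v0 N p' v' lam' z'"
  unfolding iterates_upto_def
proof (intro conjI allI impI; (elim conjE)?)
  note it = assms(1)[unfolded iterates_upto_def]
  fix t :: real assume t: "t \<ge> 0"
  show "p' 0 t = p0" "v' 0 t = v0" "p' 1 t = Linv (v' 0) t"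
    using it t eq(1)[of 0] eq(1)[of 1] eq(2)[of 0] assms(2) by auto
next
  fix n assume n: "2 \<le> n" "n \<le> N"
  note it = conjunct2[OF assms(1)[unfolded iterates_upto_def], rule_format, OF conjI[OF n]]
  have e: "p' n = p n" "v' (n - 1) = v (n - 1)" "lam' (n - 2) = lam (n - 2)"
    using eq(1)[of n] eq(2)[of "n - 1"] eq(3)[of "n - 2"] n by auto
  show "continuous_on {0..} (lam' (n - 2))" "p' n differentiable_on {0..}"
    unfolding e using it by auto
  show "v' (n - 1) t = Lop (p' n) t" if "t \<ge> 0" for t
    unfolding e using it that by auto
  have "solves_system M f g G p v lam z n (p n) (Linv (Linv (lam (n - 2))))"
    using it by auto
  also have "?this \<longleftrightarrow> solves_system M f g G p' v' lam' z' n (p' n) (Linv (Linv (lam' (n - 2))))"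
    unfolding e by (rule solves_system_cong) (use eq n in auto)
  finally show "solves_system M f g G p' v' lam' z' n (p' n) (Linv (Linv (lam' (n - 2))))" .
  have "solves_z M f G p v lam z (n - 2)" using it by auto
  also have "?this \<longleftrightarrow> solves_z M f G p' v' lam' z' (n - 2)"
    using eq n by (intro solves_z_cong) auto
  finally show "solves_z M f G p' v' lam' z' (n - 2)" .
qed

section \<open>The Adomian scheme\<close>

locale adomian_scheme =
  fixes M :: "real^'n \<Rightarrow> real^'n^'n"
    and f :: "(real^'n) \<times> (real^'n) \<Rightarrow> real^'n"
    and g :: "real^'n \<Rightarrow> real^'l"
    and G :: "real^'n \<Rightarrow> real^'n^'l"
    and p0 v0 :: "real^'n"
  assumes smooth_M: "smooth M" and smooth_f: "smooth f" and smooth_g: "smooth g"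
    and smooth_GT: "smooth (\<lambda>x. transpose (G x))"
    and inv_M0: "invertible (M p0)"
    and inv_schur: "invertible (G p0 ** matrix_inv (M p0) ** transpose (G p0))"
begin

abbreviation (input) "M0 \<equiv> M p0"
abbreviation (input) "G0 \<equiv> G p0"
abbreviation (input) "K \<equiv> G0 ** matrix_inv M0 ** transpose G0"
abbreviation "iter \<equiv> iterates_upto M f g G p0 v0"
abbreviation "rhs \<equiv> adomian_rhs M f G"
abbreviation "R \<equiv> sysR M f G"
abbreviation "solves \<equiv> solves_system M f g G"

definition multiplier where
  "multiplier p v lam z n t =
    matrix_inv K *v (G0 *v (matrix_inv M0 *v R p v lam z n t) - sysS g p n t)"

definition position where
  "position p v lam z n t = matrix_inv M0 *v R p v lam z n t
    - matrix_inv M0 *v (transpose G0 *v multiplier p v lam z n t)"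

definition homog_before ::
  "nat \<Rightarrow> (nat \<Rightarrow> real \<Rightarrow> real^'n) \<Rightarrow> (nat \<Rightarrow> real \<Rightarrow> real^'n) \<Rightarrow> (nat \<Rightarrow> real \<Rightarrow> real^'l)
    \<Rightarrow> (nat \<Rightarrow> real \<Rightarrow> real^'n) \<Rightarrow> bool" where
  "homog_before n p v lam z \<longleftrightarrow> (\<forall>t\<ge>0. p 0 t = p0) \<and> (\<forall>i<n. homog i (p i)) \<and>
    (\<forall>i. i + 1 < n \<longrightarrow> homog i (v i)) \<and> (\<forall>i. i + 2 < n \<longrightarrow> homog i (lam i) \<and> homog i (z i))"

lemma homog_rhs:
  fixes p v z :: "nat \<Rightarrow> real \<Rightarrow> real^'n" and lam :: "nat \<Rightarrow> real \<Rightarrow> real^'l"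
  assumes "\<And>i. i \<le> j \<Longrightarrow> homog i (p i)" "\<And>i. i \<le> j \<Longrightarrow> homog i (v i)"
    "\<And>i. i < j \<Longrightarrow> homog i (lam i)" "\<And>i. i < j \<Longrightarrow> homog i (z i)"
  shows "homog j (rhs p v lam z j)"
proof -
  have "homog j (\<lambda>t. adomian (\<lambda>x. transpose (G x)) (\<lambda>i. p i t) (j - k) *v lam k t)"
    "homog j (\<lambda>t. adomian M (\<lambda>i. p i t) (j - k) *v z k t)" if "k < j" for k
    using that assms smooth_GT smooth_M
    by (auto intro!: homog_matrix_vector_mult[OF homog_adomian, where k = k])
  then show ?thesis
    unfolding adomian_rhs_def[abs_def]
    by (intro homog_diff homog_sum homog_add homog_adomian smooth_f homog_Pair assms) auto
qed

context
  fixes n :: nat and p v z :: "nat \<Rightarrow> real \<Rightarrow> real^'n" and lam :: "nat \<Rightarrow> real \<Rightarrow> real^'l"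
  assumes n: "n \<ge> 2" and before: "homog_before n p v lam z"
begin

lemma homog_rhs_before: "homog (n - 2) (rhs p v lam z (n - 2))"
  using before n by (intro homog_rhs) (auto simp: homog_before_def)

lemma homog_R: "homog n (R p v lam z n)"
  using homog_Linv[OF homog_Linv[OF homog_rhs_before]] n
  by (simp add: sysR_def numeral_2_eq_2 Suc_diff_Suc)

lemma homog_S: "homog n (sysS g p n)"
  using before by (intro homog_sysS smooth_g) (auto simp: homog_before_def)

lemma homog_multiplier: "homog n (multiplier p v lam z n)"
  unfolding multiplier_def[abs_def] by (intro homog_matrix homog_diff homog_R homog_S)

lemma homog_position: "homog n (position p v lam z n)"
  unfolding position_def[abs_def] by (intro homog_matrix homog_diff homog_R homog_multiplier)

lemma solves_iff:
  "solves p v lam z n P \<Lambda> \<longleftrightarrow>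
    (\<forall>t\<ge>0. P t = position p v lam z n t \<and> \<Lambda> t = multiplier p v lam z n t)"
proof -
  have "M (p 0 t) *v P t + transpose (G (p 0 t)) *v \<Lambda> t = R p v lam z n t \<and>
      G (p 0 t) *v P t = sysS g p n t \<longleftrightarrow>
      P t = position p v lam z n t \<and> \<Lambda> t = multiplier p v lam z n t" if "t \<ge> 0" for t
  proof -
    have p: "p 0 t = p0" using before that by (simp add: homog_before_def)
    show ?thesis
      unfolding p saddle_system_iff[OF inv_M0 inv_schur] position_def multiplier_def
      by (auto simp del: transpose_matrix_vector)
  qed
  then show ?thesis unfolding solves_system_def by blast
qed

lemma Lop_Lop_multiplier:
  assumes "t \<ge> 0"
  shows "Lop (Lop (multiplier p v lam z n)) t = matrix_inv K *v
    (G0 *v (matrix_inv M0 *v Lop (Lop (R p v lam z n)) t) - Lop (Lop (sysS g p n)) t)"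
proof -
  have *: "Lop (\<lambda>t. A *v (B *v (C *v x t) - y t)) t = A *v (B *v (C *v Lop x t) - Lop y t)"
    if "homog k x" "homog k y" "t \<ge> 0"
    for k x y t and A :: "real^'l^'l" and B :: "real^'n^'l" and C :: "real^'n^'n"
    by (simp only: Lop_matrix[OF homog_diff[OF homog_matrix[OF homog_matrix]], OF that]
        Lop_diff[OF homog_matrix[OF homog_matrix], OF that]
        Lop_matrix[OF homog_matrix, OF that(1,3)] Lop_matrix[OF that(1,3)])
  have "Lop (Lop (multiplier p v lam z n)) t = Lop (\<lambda>t. matrix_inv K *v
      (G0 *v (matrix_inv M0 *v Lop (R p v lam z n) t) - Lop (sysS g p n) t)) t"
    unfolding multiplier_def[abs_def]
    by (intro Lop_cong * [OF homog_R homog_S] assms)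
  also have "\<dots> = matrix_inv K *v
    (G0 *v (matrix_inv M0 *v Lop (Lop (R p v lam z n)) t) - Lop (Lop (sysS g p n)) t)"
    by (intro * [OF homog_Lop[OF homog_R] homog_Lop[OF homog_S]] assms)
  finally show ?thesis .
qed

end

lemma homog_before_1:
  assumes "iter 1 p v lam z" shows "homog_before 2 p v lam z"
proof -
  have it: "\<And>t. t \<ge> 0 \<Longrightarrow> p 0 t = p0" "\<And>t. t \<ge> 0 \<Longrightarrow> v 0 t = v0"
    "\<And>t. t \<ge> 0 \<Longrightarrow> p 1 t = Linv (v 0) t"
    using assms unfolding iterates_upto_def by auto
  have "homog 0 (p 0)" by (rule homogI[where c = p0]) (simp add: it)
  moreover have v: "homog 0 (v 0)" by (rule homogI[where c = v0]) (simp add: it)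
  moreover have "homog 1 (p 1)"
    using homog_Linv[OF v] homog_cong[of "p 1" "Linv (v 0)"] it(3) by simp
  ultimately show ?thesis
    using it(1) by (auto simp: homog_before_def less_2_cases_iff)
qed

text \<open>Induction over the steps: the right-hand sides of step \<open>n\<close> are monomials of degree \<open>n\<close>,
  hence so are the solution \<open>p n\<close> and the twofold integral of \<open>lam (n - 2)\<close>; differentiation gives
  the degrees of \<open>v (n - 1)\<close> and of the multiplier itself, and the equation for \<open>z (n - 2)\<close> its
  degree.\<close>

lemma iter_homog:
  assumes "iter N p v lam z" "N \<ge> 1" shows "homog_before (Suc N) p v lam z"
  using assms(2,1)
proof (induction N rule: dec_induct)
  case base
  then show ?case using homog_before_1 by (simp add: numeral_2_eq_2)
next
  case (step N)
  define n where "n = Suc N"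
  have n: "n \<ge> 2" using step.hyps by (simp add: n_def)
  have before: "homog_before n p v lam z"
    using step.IH iterates_upto_mono[OF step.prems] by (simp add: n_def)
  have it: "continuous_on {0..} (lam (n - 2))"
      "solves p v lam z n (p n) (Linv (Linv (lam (n - 2))))"
      "\<And>t. t \<ge> 0 \<Longrightarrow> v (n - 1) t = Lop (p n) t" "solves_z M f G p v lam z (n - 2)"
    using step.prems n unfolding iterates_upto_def n_def[symmetric] by auto
  have sol: "p n t = position p v lam z n t"
      "Linv (Linv (lam (n - 2))) t = multiplier p v lam z n t" if "t \<ge> 0" for t
    using it(2) that unfolding solves_iff[OF n before] by auto
  have p: "homog n (p n)"
    using homog_position[OF n before] homog_cong[OF sol(1)] by simp
  have v: "homog (n - 1) (v (n - 1))"
    using homog_Lop[OF p] homog_cong[OF it(3)] by simp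
  have "homog n (Linv (Linv (lam (n - 2))))"
    using homog_multiplier[OF n before] homog_cong[OF sol(2)] by simp
  from homog_Lop[OF homog_Lop[OF this]]
  have "homog (n - 2) (Lop (Lop (Linv (Linv (lam (n - 2))))))"
    by (simp add: numeral_2_eq_2)
  then have lam: "homog (n - 2) (lam (n - 2))"
    using homog_cong[OF Lop_Lop_Linv_Linv[OF it(1)]] by simp
  have "z (n - 2) t = matrix_inv M0 *v (rhs p v lam z (n - 2) t - transpose G0 *v lam (n - 2) t)"
    if "t \<ge> 0" for t
  proof -
    have p: "p 0 t = p0" using before that by (simp add: homog_before_def)
    have "M (p 0 t) *v z (n - 2) t = rhs p v lam z (n - 2) t - transpose (G (p 0 t)) *v lam (n - 2) t"
      using it(4) that unfolding solves_z_def by blast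
    then have "M0 *v z (n - 2) t = rhs p v lam z (n - 2) t - transpose G0 *v lam (n - 2) t"
      unfolding p .
    then show ?thesis using matrix_inv_mult(2)[OF inv_M0, of "z (n - 2) t"] by simp
  qed
  note z_eq = homog_cong[OF this]
  have z: "homog (n - 2) (z (n - 2))"
    by (intro iffD2[OF z_eq] homog_matrix homog_diff homog_rhs_before n before lam)
  have "i = n - 1" if "i + 1 = n" for i using that by simp
  moreover have "i = n - 2" if "i + 2 = n" for i using that by simp
  moreover have "i < Suc n \<longleftrightarrow> i < n \<or> i = n" "i + 1 < Suc n \<longleftrightarrow> i + 1 < n \<or> i + 1 = n"
    "i + 2 < Suc n \<longleftrightarrow> i + 2 < n \<or> i + 2 = n" for i by auto
  ultimately have "homog_before (Suc n) p v lam z"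
    using before p v lam z unfolding homog_before_def by metis
  then show ?case by (simp add: n_def)
qed

lemma iter_before:
  assumes "n \<ge> 2" "iter (n - 1) p v lam z" shows "homog_before n p v lam z"
  using iter_homog[OF assms(2)] assms(1) by simp

text \<open>The multiplier of the new step is obtained by differentiating twice the solution of the
  linear system, which is a monomial of degree \<open>n \<ge> 2\<close>; integrating it twice therefore returns
  that solution.\<close>

lemma iter_extend:
  assumes n: "n \<ge> 2" and it: "iter (n - 1) p v lam z"
  defines "P \<equiv> position p v lam z n" and "mu \<equiv> Lop (Lop (multiplier p v lam z n))"
  shows "continuous_on {0..} mu"
    and "solves p v lam z n P (Linv (Linv mu))"
    and "\<exists>w y. iter n (p(n := P)) (v(n - 1 := w)) (lam(n - 2 := mu)) (z(n - 2 := y))"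
proof -
  have before: "homog_before n p v lam z" by (rule iter_before[OF n it])
  show mu: "continuous_on {0..} mu"
    unfolding mu_def
    by (rule homog_continuous_on[OF homog_Lop[OF homog_Lop[OF homog_multiplier[OF n before]]]])
  have "Linv (Linv mu) t = multiplier p v lam z n t" if "t \<ge> 0" for t
    unfolding mu_def by (rule Linv_Linv_Lop_Lop[OF homog_multiplier[OF n before] n that])
  then show sol: "solves p v lam z n P (Linv (Linv mu))"
    unfolding solves_iff[OF n before] by (simp add: P_def)
  define y where "y t = matrix_inv M0 *v (rhs p v lam z (n - 2) t - transpose G0 *v mu t)" for t
  let ?p = "p(n := P)" and ?v = "v(n - 1 := Lop P)" and ?lam = "lam(n - 2 := mu)"
    and ?z = "z(n - 2 := y)"
  have "iter n ?p ?v ?lam ?z"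
    unfolding iterates_upto_step[OF n]
  proof (intro conjI)
    show "iter (n - 1) ?p ?v ?lam ?z"
      using n by (intro iterates_upto_cong_imp[OF it]) auto
    show "continuous_on {0..} (?lam (n - 2))" using mu by simp
    have "solves ?p ?v ?lam ?z n P (Linv (Linv mu))"
      using sol n by (subst solves_system_cong[of n ?p p ?v v ?lam lam ?z z]) auto
    then show "solves ?p ?v ?lam ?z n (?p n) (Linv (Linv (?lam (n - 2))))" by simp
    show "?p n differentiable_on {0..}"
      using homog_differentiable_on[OF homog_position[OF n before]] by (simp add: P_def)
    show "\<forall>t\<ge>0. ?v (n - 1) t = Lop (?p n) t" by simp
    have "rhs ?p ?v ?lam ?z (n - 2) = rhs p v lam z (n - 2)"
      using n by (intro adomian_rhs_cong) auto
    moreover have "?p 0 t = p0" if "t \<ge> 0" for t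
      using before n that by (simp add: homog_before_def)
    ultimately show "solves_z M f G ?p ?v ?lam ?z (n - 2)"
      unfolding solves_z_def by (simp add: y_def matrix_inv_mult(1)[OF inv_M0])
  qed
  then show "\<exists>w y. iter n (p(n := P)) (v(n - 1 := w)) (lam(n - 2 := mu)) (z(n - 2 := y))"
    by blast
qed

text \<open>The steps are performed one after the other by dependent choice.  Each step overwrites
  only entries that earlier steps left unconstrained, so every entry is eventually constant and the
  diagonal sequence obeys all relations.\<close>

lemma iter_exists: "\<exists>p v lam z. \<forall>N. iter N p v lam z"
proof -
  define I where "I N = (\<lambda>(p, v, lam, z). iter N p v lam z)" for N
  define ext where "ext n s s' \<longleftrightarrow> (case s of (p, v, lam, z) \<Rightarrow> \<exists>P w mu y.
      s' = (p(n := P), v(n - 1 := w), lam(n - 2 := mu), z(n - 2 := y)))"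
    for n :: nat and s s' :: "(nat \<Rightarrow> real \<Rightarrow> real^'n) \<times> (nat \<Rightarrow> real \<Rightarrow> real^'n)
      \<times> (nat \<Rightarrow> real \<Rightarrow> real^'l) \<times> (nat \<Rightarrow> real \<Rightarrow> real^'n)"
  have "\<exists>s. \<forall>m. I (Suc m) (s m) \<and> ext (Suc (Suc m)) (s m) (s (Suc m))"
  proof (rule dependent_nat_choice[where P = "\<lambda>m. I (Suc m)" and Q = "\<lambda>m. ext (Suc (Suc m))"])
    have "iter 1 ((\<lambda>_ _. p0)(1 := Linv (\<lambda>_. v0))) (\<lambda>_ _. v0) (\<lambda>_ _. 0) (\<lambda>_ _. 0)"
      unfolding iterates_upto_def by (rule conjI, simp, intro allI impI, linarith)
    then have "I (Suc 0) ((\<lambda>_ _. p0)(1 := Linv (\<lambda>_. v0)), (\<lambda>_ _. v0), (\<lambda>_ _. 0), (\<lambda>_ _. 0))"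
      by (simp add: I_def)
    then show "\<exists>s. I (Suc 0) s" by blast
    fix s m assume "I (Suc m) s"
    then obtain p v lam z where s: "s = (p, v, lam, z)" and it: "iter (Suc m) p v lam z"
      unfolding I_def by (cases s) (simp only: prod.case)
    let ?n = "Suc (Suc m)"
    obtain P w mu y where
      "iter ?n (p(?n := P)) (v(?n - 1 := w)) (lam(?n - 2 := mu)) (z(?n - 2 := y))"
      using iter_extend(3)[of ?n p v lam z] it by (simp only: diff_Suc_1) auto
    then have I: "I ?n (p(?n := P), v(?n - 1 := w), lam(?n - 2 := mu), z(?n - 2 := y))"
      unfolding I_def by simp
    have ext: "ext ?n s (p(?n := P), v(?n - 1 := w), lam(?n - 2 := mu), z(?n - 2 := y))"
      unfolding ext_def s prod.case by ((rule exI)+, rule refl)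
    show "\<exists>s'. I ?n s' \<and> ext ?n s s'" using conjI[OF I ext] by (rule exI)
  qed
  then obtain s where s: "\<And>m. I (Suc m) (s m)" "\<And>m. ext (Suc (Suc m)) (s m) (s (Suc m))"
    by blast
  define p v lam z where "p m = fst (s m)" and "v m = fst (snd (s m))"
    and "lam m = fst (snd (snd (s m)))" and "z m = snd (snd (snd (s m)))" for m
  have it: "iter (Suc m) (p m) (v m) (lam m) (z m)" for m
    using s(1)[of m] unfolding I_def p_def v_def lam_def z_def by (simp add: case_prod_beta)
  have step: "i \<le> Suc m \<Longrightarrow> p (Suc m) i = p m i" "i \<le> m \<Longrightarrow> v (Suc m) i = v m i"
      "i < m \<Longrightarrow> lam (Suc m) i = lam m i" "i < m \<Longrightarrow> z (Suc m) i = z m i" for m i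
    using s(2)[of m] unfolding ext_def p_def v_def lam_def z_def by auto
  have stable: "m \<ge> i \<Longrightarrow> p m i = p i i" "m \<ge> i \<Longrightarrow> v m i = v i i"
      "m \<ge> Suc i \<Longrightarrow> lam m i = lam (Suc i) i" "m \<ge> Suc i \<Longrightarrow> z m i = z (Suc i) i" for m i
    by (induction m rule: dec_induct; simp add: step)+
  have "iter N (\<lambda>i. p i i) (\<lambda>i. v i i) (\<lambda>i. lam (Suc i) i) (\<lambda>i. z (Suc i) i)" if "N \<ge> 1" for N
  proof (rule iterates_upto_cong_imp[OF iterates_upto_mono[OF it] that])
    show "N \<le> Suc N" by simp
    show "p N i = p i i" if "i \<le> N" for i using that by (rule stable(1))
    show "v N i = v i i" if "i < N" for i using less_imp_le[OF that] by (rule stable(2))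
    show "lam N i = lam (Suc i) i \<and> z N i = z (Suc i) i" if "i + 2 \<le> N" for i
      using that by (intro conjI stable(3,4)) simp_all
  qed
  then have "iter N (\<lambda>i. p i i) (\<lambda>i. v i i) (\<lambda>i. lam (Suc i) i) (\<lambda>i. z (Suc i) i)" for N
    by (rule iterates_upto_mono[of _ _ _ _ _ _ "Suc N"]) auto
  then show ?thesis by blast
qed

end

section \<open>Solvability and explicit solution\<close>

theorem mainTheorem2:
  fixes M :: "real^'n \<Rightarrow> real^'n^'n"
    and f :: "(real^'n) \<times> (real^'n) \<Rightarrow> real^'n"
    and g :: "real^'n \<Rightarrow> real^'l"
    and G :: "real^'n \<Rightarrow> real^'n^'l"
    and p0 v0 :: "real^'n"
  assumes "CARD('l) \<le> CARD('n)"
    and "real_analytic M" and "real_analytic f" and "real_analytic g"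
    and "\<And>x. G x = jacobian g (at x)"
    and "\<And>x. rank (G x) = CARD('l)"
    and "\<And>x. transpose (M x) = M x" and "\<And>x. pos_def (M x)"
    and "g p0 = 0" and "G p0 *v v0 = 0"
  shows "(\<exists>p v lam z. \<forall>N. iterates_upto M f g G p0 v0 N p v lam z)
    \<and> (\<forall>n\<ge>2. \<forall>p v lam z. iterates_upto M f g G p0 v0 (n - 1) p v lam z \<longrightarrow>
        (let M0 = M p0; G0 = G p0;
             R = sysR M f G p v lam z n; S = sysS g p n;
             K = G0 ** matrix_inv M0 ** transpose G0
         in
           invertible M0 \<and> invertible K \<and>
           continuous_on {0..} (adomian_rhs M f G p v lam z (n - 2)) \<and>
           R differentiable_on {0..} \<and> Lop R differentiable_on {0..} \<and>
           S differentiable_on {0..} \<and> Lop S differentiable_on {0..} \<and>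
           (\<exists>P mu. continuous_on {0..} mu \<and>
              solves_system M f g G p v lam z n P (Linv (Linv mu)) \<and>
              (\<forall>P' \<Lambda>'. solves_system M f g G p v lam z n P' \<Lambda>' \<longrightarrow>
                (\<forall>t\<ge>0. P' t = P t \<and> \<Lambda>' t = Linv (Linv mu) t)) \<and>
              (\<forall>mu'. continuous_on {0..} mu' \<and> (\<forall>t\<ge>0. Linv (Linv mu') t = Linv (Linv mu) t) \<longrightarrow>
                (\<forall>t\<ge>0. mu' t = mu t)) \<and>
              (\<exists>w y. iterates_upto M f g G p0 v0 n
                 (p(n := P)) (v(n - 1 := w)) (lam(n - 2 := mu)) (z(n - 2 := y))) \<and>
              (\<forall>t\<ge>0.
                Linv (Linv mu) t = matrix_inv K *v (G0 *v (matrix_inv M0 *v R t) - S t) \<and>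
                mu t = matrix_inv K *v
                  (G0 *v (matrix_inv M0 *v Lop (Lop R) t) - Lop (Lop S) t) \<and>
                P t = matrix_inv M0 *v R t
                  - matrix_inv M0 *v (transpose G0 *v
                      (matrix_inv K *v (G0 *v (matrix_inv M0 *v R t) - S t)))))))"
proof -
  interpret adomian_scheme M f g G p0 v0
  proof
    show "smooth M" "smooth f" and g: "smooth g"
      using assms(2-4) by (auto intro: real_analytic_smooth)
    show "smooth (\<lambda>x. transpose (G x))"
      unfolding assms(5) by (rule smooth_transpose_jacobian[OF g])
    show "invertible (M p0)" using assms(8) by (rule pos_def_invertible)
    show "invertible (G p0 ** matrix_inv (M p0) ** transpose (G p0))"
      using pos_def_schur[OF assms(8,6)] by (rule pos_def_invertible)
  qed
  have step: "let M0 = M p0; G0 = G p0;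
      R = sysR M f G p v lam z n; S = sysS g p n;
      K = G0 ** matrix_inv M0 ** transpose G0
    in invertible M0 \<and> invertible K \<and>
      continuous_on {0..} (adomian_rhs M f G p v lam z (n - 2)) \<and>
      R differentiable_on {0..} \<and> Lop R differentiable_on {0..} \<and>
      S differentiable_on {0..} \<and> Lop S differentiable_on {0..} \<and>
      (\<exists>P mu. continuous_on {0..} mu \<and>
        solves_system M f g G p v lam z n P (Linv (Linv mu)) \<and>
        (\<forall>P' \<Lambda>'. solves_system M f g G p v lam z n P' \<Lambda>' \<longrightarrow>
          (\<forall>t\<ge>0. P' t = P t \<and> \<Lambda>' t = Linv (Linv mu) t)) \<and>
        (\<forall>mu'. continuous_on {0..} mu' \<and> (\<forall>t\<ge>0. Linv (Linv mu') t = Linv (Linv mu) t) \<longrightarrow>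
          (\<forall>t\<ge>0. mu' t = mu t)) \<and>
        (\<exists>w y. iterates_upto M f g G p0 v0 n
           (p(n := P)) (v(n - 1 := w)) (lam(n - 2 := mu)) (z(n - 2 := y))) \<and>
        (\<forall>t\<ge>0.
          Linv (Linv mu) t = matrix_inv K *v (G0 *v (matrix_inv M0 *v R t) - S t) \<and>
          mu t = matrix_inv K *v (G0 *v (matrix_inv M0 *v Lop (Lop R) t) - Lop (Lop S) t) \<and>
          P t = matrix_inv M0 *v R t - matrix_inv M0 *v (transpose G0 *v
            (matrix_inv K *v (G0 *v (matrix_inv M0 *v R t) - S t)))))"
    if n: "n \<ge> 2" and it: "iterates_upto M f g G p0 v0 (n - 1) p v lam z" for n p v lam z
  proof -
    define P where "P = position p v lam z n"
    define mu where "mu = Lop (Lop (multiplier p v lam z n))"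
    note before = iter_before[OF n it]
    note ext = iter_extend[OF n it, folded P_def mu_def]
    note hR = homog_R[OF n before] and hS = homog_S[OF n before]
    have Lmu: "Linv (Linv mu) t = multiplier p v lam z n t" if "t \<ge> 0" for t
      using ext(2) that unfolding solves_iff[OF n before] by blast
    have uniq: "P' t = P t \<and> \<Lambda>' t = Linv (Linv mu) t"
      if "solves_system M f g G p v lam z n P' \<Lambda>'" "t \<ge> 0" for P' \<Lambda>' t
      using that unfolding solves_iff[OF n before] by (simp add: P_def Lmu)
    have inj: "mu' t = mu t" if mu': "continuous_on {0..} mu'"
        "\<And>t. t \<ge> 0 \<Longrightarrow> Linv (Linv mu') t = Linv (Linv mu) t" and t: "t \<ge> 0" for mu' t
    proof -
      have "Lop (Linv (Linv mu')) s = Lop (Linv (Linv mu)) s" if "s \<ge> 0" for s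
        by (intro Lop_cong mu'(2) that)
      then have "Lop (Lop (Linv (Linv mu'))) t = Lop (Lop (Linv (Linv mu))) t"
        by (intro Lop_cong[of "Lop (Linv (Linv mu'))"] t)
      then show ?thesis
        by (simp only: Lop_Lop_Linv_Linv[OF mu'(1) t] Lop_Lop_Linv_Linv[OF ext(1) t])
    qed
    show ?thesis
      unfolding Let_def
    proof (intro conjI;
        (rule exI[of _ P], rule exI[of _ mu], intro conjI allI impI; (elim conjE)?)?)
      show "invertible (M p0)" by (rule inv_M0)
      show "invertible (G p0 ** matrix_inv (M p0) ** transpose (G p0))" by (rule inv_schur)
      show "continuous_on {0..} (adomian_rhs M f G p v lam z (n - 2))"
        by (rule homog_continuous_on[OF homog_rhs_before[OF n before]])
      show "sysR M f G p v lam z n differentiable_on {0..}"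
          "Lop (sysR M f G p v lam z n) differentiable_on {0..}"
          "sysS g p n differentiable_on {0..}" "Lop (sysS g p n) differentiable_on {0..}"
        by (rule homog_differentiable_on[OF hR] homog_differentiable_on[OF homog_Lop[OF hR]]
            homog_differentiable_on[OF hS] homog_differentiable_on[OF homog_Lop[OF hS]])+
      show "continuous_on {0..} mu" by (rule ext(1))
      show "solves_system M f g G p v lam z n P (Linv (Linv mu))" by (rule ext(2))
      show "\<exists>w y. iterates_upto M f g G p0 v0 n
          (p(n := P)) (v(n - 1 := w)) (lam(n - 2 := mu)) (z(n - 2 := y))" by (rule ext(3))
    next
      fix P' \<Lambda>' and t :: real
      assume "solves_system M f g G p v lam z n P' \<Lambda>'" "t \<ge> 0"
      from uniq[OF this] show "P' t = P t" "\<Lambda>' t = Linv (Linv mu) t" by blast+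
    next
      fix mu' and t :: real
      assume "continuous_on {0..} mu'" "\<forall>t\<ge>0. Linv (Linv mu') t = Linv (Linv mu) t" "t \<ge> 0"
      then show "mu' t = mu t" using inj by blast
    next
      fix t :: real assume t: "t \<ge> 0"
      show "Linv (Linv mu) t = matrix_inv (G p0 ** matrix_inv (M p0) ** transpose (G p0)) *v
          (G p0 *v (matrix_inv (M p0) *v sysR M f G p v lam z n t) - sysS g p n t)"
        unfolding Lmu[OF t] by (rule multiplier_def)
      show "mu t = matrix_inv (G p0 ** matrix_inv (M p0) ** transpose (G p0)) *v
          (G p0 *v (matrix_inv (M p0) *v Lop (Lop (sysR M f G p v lam z n)) t)
            - Lop (Lop (sysS g p n)) t)"
        unfolding mu_def by (rule Lop_Lop_multiplier[OF n before t])
      show "P t = matrix_inv (M p0) *v sysR M f G p v lam z n t - matrix_inv (M p0) *v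
          (transpose (G p0) *v (matrix_inv (G p0 ** matrix_inv (M p0) ** transpose (G p0)) *v
            (G p0 *v (matrix_inv (M p0) *v sysR M f G p v lam z n t) - sysS g p n t)))"
        unfolding P_def position_def multiplier_def ..
    qed
  qed
  show ?thesis
    using iter_exists step by blast
qed

end
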